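(* Let $A\in \mathrm{Mat}^+(2,\mathbb{Z})$, the monoid of all $2\times 2$ integer matrices with positive determinant, and let $\mathbf{D}$ and $\mathbf{D}'$ be NET map presentation diagrams such that $A$ sends the projective class $[\mathbf{D}]$ to the projective class $[\mathbf{D}']$. Let $F,F':(S_2^2,P_2)\to(S_2^2,P_2)$ be the Thurston maps corresponding to $[\mathbf{D}]$ and $[\mathbf{D}']$. Then $F'=A_2\circ F$ (as isotopy classes rel $P_2$), where $A_2:(S_2^2,P_2)\to(S_2^2,P_2)$ is the map induced by $A$.
   Context: **Thurston maps and NET maps.** A Thurston map is an orientation-preserving branched covering of an oriented 2-sphere, of degree at least 2, with finite postcritical set (the union of the forward images, under positive iterates, of the set of critical points). It is a NET map if every critical point is simple and the postcritical set has exactly four points. **Presentation data.** Let $\Lambda_2=\mathbb{Z}^2\subset\mathbb{R}^2$. The data consist of the following. (1) An ordered basis $(\lambda_1,\lambda_2)$ of a proper sublattice $\Lambda_1$ of $\Lambda_2$ (of rank 2) such that the matrix $[\lambda_1,\lambda_2]$ with these columns has positive determinant. (2) An element $b\in\{0,\lambda_1,\lambda_2,\lambda_1+\lambda_2\}$. For $i=1,2$ let $\Gamma_i=\{x\mapsto 2\lambda\pm x:\lambda\in\Lambda_i\}$, let $S_i^2=\mathbb{R}^2/\Gamma_i$ (a topological 2-sphere), let $\pi_i:\mathbb{R}^2\to S_i^2$ be the quotient map, and let $P_i=\pi_i(\Lambda_i)$ (four points). Let $F_1$ be the closed parallelogram with corners $0,2\lambda_1,\lambda_2,2\lambda_1+\lambda_2$;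 it is a fundamental domain for $\Gamma_1$. (3) For each of the four points $p_j\in P_1$, a (possibly degenerate, i.e. constant) geodesic arc $\beta_j$ in $S_1^2$ (for the flat structure induced from $\mathbb{R}^2$) with initial endpoint $p_j$ and terminal endpoint in $\pi_1(\Lambda_2)$, such that the four arcs $\beta_j$ are pairwise disjoint and each $\beta_j$ lifts under $\pi_1$ to a line segment contained in $F_1$. **The maps determined by the data.** Let $\Phi(x)=[\lambda_1,\lambda_2]x+b$, an affine isomorphism of $\mathbb{R}^2$ with $\Phi(\Lambda_2)=\Lambda_1$. It induces a homeomorphism $\phi:(S_2^2,P_2)\to(S_1^2,P_1)$ with $\phi\circ\pi_2=\pi_1\circ\Phi$. The identity map of $\mathbb{R}^2$ induces a branched covering $\overline{\mathrm{id}}:S_1^2\to S_2^2$ with $\overline{\mathrm{id}}\circ\pi_1=\pi_2$. Let $P$ be the set of the four terminal endpoints of the arcs $\beta_j$. Let $h:(S_1^2,P_1)\to(S_1^2,P)$ be a push-point homeomorphism along the $\beta_j$: there are pairwise disjoint closed disks whose interiors contain the respective arcs $\beta_j$, $h$ is a homeomorphism that is the identity outside these disks, it maps each of these disks to itself, and it maps the initial endpoint of each $\beta_j$ to its terminal endpoint (with $h$ trivial at degenerate arcs). Such $h$ is unique up to isotopy rel $P_1$. The Thurston map corresponding to the data is $F=\overline{\mathrm{id}}\circ h\circ\phi:(S_2^2,P_2)\to(S_2^2,P_2)$; its postcritical set is contained in $P_2$, and it is well defined up to isotopy rel $P_2$. Here two branched coverings $F,G$ of $S_2^2$ mapping $P_2$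 into $P_2$ represent the same isotopy class rel $P_2$ if $G=F\circ\theta$ for some homeomorphism $\theta$ isotopic to the identity rel $P_2$. **NET map presentation diagram.** Data (1), (2), (3) for which the postcritical set of $F$ is all of $P_2$ (equivalently $F$ is a NET map) are called a NET map presentation, encoded by the NET map presentation diagram $\mathbf{D}$ (a drawing of $F_1$ with $b$ marked and all lifts of the $\beta_j$ to $F_1$ drawn). **Action and projective classes.** A matrix $A\in\mathrm{Mat}^+(2,\mathbb{Z})$ acts on diagrams by applying the linear map $x\mapsto Ax$: $A\cdot\mathbf{D}$ has ordered basis $(A\lambda_1,A\lambda_2)$, marked point $Ab$, and as lifts of its arcs the images under $A$ of the lifts of the arcs of $\mathbf{D}$. The projective class of $\mathbf{D}$ is $[\mathbf{D}]=\{\mathbf{D},-\mathbf{D}\}$, where $-\mathbf{D}=(-I)\cdot\mathbf{D}$; $A$ sends $[\mathbf{D}]$ to $[A\cdot\mathbf{D}]$. The isotopy class of $F$ depends only on $[\mathbf{D}]$. **Induced map.** Since $A(\Lambda_2)\subseteq\Lambda_2$, the linear map $x\mapsto Ax$ induces a branched covering (a homeomorphism if $\det A=1$) $A_2:(S_2^2,P_2)\to(S_2^2,P_2)$ with $A_2\circ\pi_2(x)=\pi_2(Ax)$. *)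

theory Defs
  imports "HOL-Analysis.Analysis"
begin

section \<open>Flat quotient spheres\<close>

type_synonym plane = "real^2"

definition int_lattice :: "plane set" where
  "int_lattice = {x. \<forall>i. x $ i \<in> \<int>}"

definition Gam :: "plane set \<Rightarrow> (plane \<Rightarrow> plane) set" where
  "Gam L = {g. \<exists>l\<in>L. g = (\<lambda>x. 2 *\<^sub>R l + x) \<or> g = (\<lambda>x. 2 *\<^sub>R l - x)}"

text \<open>Points of the quotient of the plane by \<open>Gam L\<close> are orbits, i.e. sets of points of the plane;
  the quotient map is \<open>proj L\<close>.\<close>

definition proj :: "plane set \<Rightarrow> plane \<Rightarrow> plane set" where
  "proj L x = {g x | g. g \<in> Gam L}"

definition qsphere :: "plane set \<Rightarrow> plane set topology" where
  "qsphere L = topology (\<lambda>U. U \<subseteq> range (proj L) \<and> open (proj L -` U))"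

lemma istopology_qsphere: "istopology (\<lambda>U. U \<subseteq> range (proj L) \<and> open (proj L -` U))"
  unfolding istopology_def
proof (intro conjI allI impI)
  fix S T assume "S \<subseteq> range (proj L) \<and> open (proj L -` S)" "T \<subseteq> range (proj L) \<and> open (proj L -` T)"
  then show "S \<inter> T \<subseteq> range (proj L)" "open (proj L -` (S \<inter> T))"
    by (blast, simp only: vimage_Int open_Int)
next
  fix K assume K: "\<forall>S\<in>K. S \<subseteq> range (proj L) \<and> open (proj L -` S)"
  then show "\<Union>K \<subseteq> range (proj L)" by blast
  show "open (proj L -` \<Union>K)" unfolding vimage_Union using K by (intro open_UN) blast
qed

lemma openin_qsphere:
  "openin (qsphere L) U \<longleftrightarrow> U \<subseteq> range (proj L) \<and> open (proj L -` U)"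
  unfolding qsphere_def topology_inverse'[OF istopology_qsphere] by (rule refl)

lemma topspace_qsphere: "topspace (qsphere L) = range (proj L)"
proof (rule subset_antisym)
  show "topspace (qsphere L) \<subseteq> range (proj L)"
    using openin_topspace[of "qsphere L"] unfolding openin_qsphere by (rule conjunct1)
  have "proj L -` range (proj L) = UNIV" by blast
  then have "openin (qsphere L) (range (proj L))"
    unfolding openin_qsphere by (simp only: open_UNIV subset_refl simp_thms)
  then show "range (proj L) \<subseteq> topspace (qsphere L)"
    by (rule openin_subset)
qed

lemma quotient_map_proj: "quotient_map euclidean (qsphere L) (proj L)"
  unfolding quotient_map_def topspace_qsphere openin_qsphere topspace_euclidean open_openin[symmetric]
    vimage_def mem_Collect_eq by (simp only: UNIV_I simp_thms) blast

definition cone_points :: "plane set \<Rightarrow> plane set set" where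
  "cone_points L = proj L ` L"

text \<open>The map of quotients induced by a map \<open>f\<close> of the plane that carries \<open>Gam L\<close>-orbits into
  \<open>Gam M\<close>-orbits: the orbit of \<open>x\<close> goes to the orbit of \<open>f x\<close>.\<close>

definition induced :: "plane set \<Rightarrow> plane set \<Rightarrow> (plane \<Rightarrow> plane) \<Rightarrow> plane set \<Rightarrow> plane set" where
  "induced L M f c = the_elem ((\<lambda>x. proj M (f x)) ` c)"

lemma induced_proj:
  assumes "0 \<in> L" and "\<And>y. y \<in> proj L x \<Longrightarrow> proj M (f y) = proj M (f x)"
  shows "induced L M f (proj L x) = proj M (f x)"
proof -
  have "(\<lambda>y. 2 *\<^sub>R 0 + y) \<in> Gam L"
    using assms(1) unfolding Gam_def by blast
  then have "2 *\<^sub>R 0 + x \<in> proj L x"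
    unfolding proj_def by blast
  then have x: "x \<in> proj L x"
    by (simp only: scaleR_zero_right add_0_left)
  have "(\<lambda>y. proj M (f y)) ` proj L x = {proj M (f x)}"
  proof (rule subset_antisym)
    show "(\<lambda>y. proj M (f y)) ` proj L x \<subseteq> {proj M (f x)}"
      using assms(2) by (intro image_subsetI) (simp only: singleton_iff)
    show "{proj M (f x)} \<subseteq> (\<lambda>y. proj M (f y)) ` proj L x"
      using x by blast
  qed
  then show ?thesis unfolding induced_def by (simp only: the_elem_eq)
qed

section \<open>Branched coverings, postcritical sets and isotopy\<close>

text \<open>Every point \<open>y\<close> has a neighbourhood \<open>V\<close>, a coordinate disk centred at \<open>y\<close>, over which the map is
  a disjoint union of copies of \<open>z \<mapsto> z ^ k\<close> on the unit disk, \<open>k \<ge> 1\<close> depending on the copy.\<close>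

definition branched_covering :: "'a topology \<Rightarrow> 'b topology \<Rightarrow> ('a \<Rightarrow> 'b) \<Rightarrow> bool" where
  "branched_covering X Y f \<longleftrightarrow>
     continuous_map X Y f \<and> f ` topspace X = topspace Y \<and>
     (\<forall>y\<in>topspace Y. \<exists>V v \<U>.
        openin Y V \<and> y \<in> V \<and>
        homeomorphic_map (subtopology Y V) (top_of_set (ball (0::complex) 1)) v \<and> v y = 0 \<and>
        (\<forall>U\<in>\<U>. openin X U) \<and> pairwise disjnt \<U> \<and> \<Union>\<U> = {x \<in> topspace X. f x \<in> V} \<and>
        (\<forall>U\<in>\<U>. \<exists>u k.
           homeomorphic_map (subtopology X U) (top_of_set (ball (0::complex) 1)) u \<and>
           k \<ge> (1::nat) \<and> (\<forall>x\<in>U. v (f x) = u x ^ k)))"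

definition critical_points :: "'a topology \<Rightarrow> 'b topology \<Rightarrow> ('a \<Rightarrow> 'b) \<Rightarrow> 'a set" where
  "critical_points X Y f =
     {x \<in> topspace X. \<not> (\<exists>U. openin X U \<and> x \<in> U \<and> openin Y (f ` U) \<and>
        homeomorphic_map (subtopology X U) (subtopology Y (f ` U)) f)}"

definition postcritical_set :: "'a topology \<Rightarrow> ('a \<Rightarrow> 'a) \<Rightarrow> 'a set" where
  "postcritical_set X f = (\<Union>n\<in>{1..}. (f ^^ n) ` critical_points X X f)"

definition isotopic_to_id_rel :: "'a topology \<Rightarrow> 'a set \<Rightarrow> ('a \<Rightarrow> 'a) \<Rightarrow> bool" where
  "isotopic_to_id_rel X P \<theta> \<longleftrightarrow>
     homotopic_with (\<lambda>f. homeomorphic_map X X f \<and> (\<forall>p\<in>P. f p = p)) X X id \<theta>"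

definition same_isotopy_class_rel :: "'a topology \<Rightarrow> 'a set \<Rightarrow> ('a \<Rightarrow> 'a) \<Rightarrow> ('a \<Rightarrow> 'a) \<Rightarrow> bool" where
  "same_isotopy_class_rel X P f g \<longleftrightarrow>
     branched_covering X X f \<and> f ` P \<subseteq> P \<and>
     branched_covering X X g \<and> g ` P \<subseteq> P \<and>
     (\<exists>\<theta>. isotopic_to_id_rel X P \<theta> \<and> (\<forall>x\<in>topspace X. g x = f (\<theta> x)))"

section \<open>Presentation data\<close>

text \<open>The vectors \<open>lam1\<close>, \<open>lam2\<close> are the ordered basis and \<open>mark\<close> is the translation term \<open>b\<close>.
  In \<open>net_data\<close>, \<open>arc_from D p\<close> is the arc with initial endpoint \<open>p\<close>, parametrized
  on \<open>{0..1}\<close> proportionally to arc length; only its values for \<open>p\<close> one of the four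
  points \<open>cone_points (lattice1 D)\<close> and for parameters in \<open>{0..1}\<close> matter.\<close>

record net_frame =
  lam1 :: plane
  lam2 :: plane
  mark :: plane

record net_data = net_frame +
  arc_from :: "plane set \<Rightarrow> real \<Rightarrow> plane set"

text \<open>A directed segment is recorded as its pair (initial endpoint, terminal endpoint).\<close>

record net_diagram = net_frame +
  drawn_lifts :: "(plane \<times> plane) set"

definition basis_matrix :: "'z net_frame_scheme \<Rightarrow> real^2^2" where
  "basis_matrix D = transpose (vector [lam1 D, lam2 D])"

definition lattice1 :: "'z net_frame_scheme \<Rightarrow> plane set" where
  "lattice1 D = {of_int m *\<^sub>R lam1 D + of_int n *\<^sub>R lam2 D | m n :: int. True}"

definition fund_domain :: "'z net_frame_scheme \<Rightarrow> plane set" where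
  "fund_domain D =
     convex hull {0, 2 *\<^sub>R lam1 D, lam2 D, 2 *\<^sub>R lam1 D + lam2 D}"

abbreviation proj1 :: "'z net_frame_scheme \<Rightarrow> plane \<Rightarrow> plane set" where
  "proj1 D \<equiv> proj (lattice1 D)"

abbreviation sphere1 :: "'z net_frame_scheme \<Rightarrow> plane set topology" where
  "sphere1 D \<equiv> qsphere (lattice1 D)"

abbreviation P1 :: "'z net_frame_scheme \<Rightarrow> plane set set" where
  "P1 D \<equiv> cone_points (lattice1 D)"

abbreviation sphere2 :: "plane set topology" where
  "sphere2 \<equiv> qsphere int_lattice"

abbreviation P2 :: "plane set set" where
  "P2 \<equiv> cone_points int_lattice"

definition segment_lift :: "'z net_frame_scheme \<Rightarrow> (real \<Rightarrow> plane set) \<Rightarrow> plane \<Rightarrow> plane \<Rightarrow> bool" where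
  "segment_lift D \<beta> s e \<longleftrightarrow>
     closed_segment s e \<subseteq> fund_domain D \<and> (\<forall>t\<in>{0..1}. \<beta> t = proj1 D (linepath s e t))"

definition degenerate_arc :: "(real \<Rightarrow> plane set) \<Rightarrow> bool" where
  "degenerate_arc \<beta> \<longleftrightarrow> (\<forall>t\<in>{0..1}. \<beta> t = \<beta> 0)"

definition presentation_data :: "net_data \<Rightarrow> bool" where
  "presentation_data D \<longleftrightarrow>
     lattice1 D \<subset> int_lattice \<and> det (basis_matrix D) > 0 \<and>
     mark D \<in> {0, lam1 D, lam2 D, lam1 D + lam2 D} \<and>
     (\<forall>p\<in>P1 D.
        (inj_on (arc_from D p) {0..1} \<or> degenerate_arc (arc_from D p)) \<and>
        arc_from D p 0 = p \<and> arc_from D p 1 \<in> proj1 D ` int_lattice \<and>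
        (\<exists>s e. segment_lift D (arc_from D p) s e)) \<and>
     disjoint_family_on (\<lambda>p. arc_from D p ` {0..1}) (P1 D)"

definition closed_disk_in :: "'a topology \<Rightarrow> 'a set \<Rightarrow> bool" where
  "closed_disk_in X B \<longleftrightarrow>
     B \<subseteq> topspace X \<and> subtopology X B homeomorphic_space top_of_set (cball (0::plane) 1)"

definition push_homeomorphism :: "net_data \<Rightarrow> (plane set \<Rightarrow> plane set) \<Rightarrow> bool" where
  "push_homeomorphism D h \<longleftrightarrow>
     homeomorphic_map (sphere1 D) (sphere1 D) h \<and>
     (\<exists>B. disjoint_family_on B (P1 D) \<and>
        (\<forall>x \<in> topspace (sphere1 D) - (\<Union>p\<in>P1 D. B p). h x = x) \<and>
        (\<forall>p\<in>P1 D.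
           closed_disk_in (sphere1 D) (B p) \<and>
           arc_from D p ` {0..1} \<subseteq> sphere1 D interior_of B p \<and>
           h ` B p = B p \<and> h p = arc_from D p 1 \<and>
           (degenerate_arc (arc_from D p) \<longrightarrow> (\<forall>x\<in>B p. h x = x))))"

definition Phi :: "'z net_frame_scheme \<Rightarrow> plane \<Rightarrow> plane" where
  "Phi D x = basis_matrix D *v x + mark D"

definition phi :: "'z net_frame_scheme \<Rightarrow> plane set \<Rightarrow> plane set" where
  "phi D = induced int_lattice (lattice1 D) (Phi D)"

definition id_bar :: "'z net_frame_scheme \<Rightarrow> plane set \<Rightarrow> plane set" where
  "id_bar D = induced (lattice1 D) int_lattice id"

definition corresponding_map :: "net_data \<Rightarrow> (plane set \<Rightarrow> plane set) \<Rightarrow> bool" where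
  "corresponding_map D F \<longleftrightarrow> (\<exists>h. push_homeomorphism D h \<and> F = id_bar D \<circ> h \<circ> phi D)"

text \<open>The postcritical set does not depend on which push homeomorphism is used, so an existential
  quantifier over the corresponding maps expresses the condition.\<close>

definition net_presentation :: "net_data \<Rightarrow> bool" where
  "net_presentation D \<longleftrightarrow> presentation_data D \<and>
     (\<exists>F. corresponding_map D F \<and> postcritical_set sphere2 F = P2)"

section \<open>Diagrams\<close>

definition diagram_of :: "net_data \<Rightarrow> net_diagram" where
  "diagram_of D = \<lparr>lam1 = lam1 D, lam2 = lam2 D, mark = mark D,
     drawn_lifts = {(s, e). \<exists>p\<in>P1 D. segment_lift D (arc_from D p) s e}\<rparr>"

definition net_map_diagram :: "net_diagram \<Rightarrow> bool" where
  "net_map_diagram \<D> \<longleftrightarrow> (\<exists>D. net_presentation D \<and> diagram_of D = \<D>)"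

definition lin :: "int^2^2 \<Rightarrow> plane \<Rightarrow> plane" where
  "lin A x = map_matrix real_of_int A *v x"

definition act :: "int^2^2 \<Rightarrow> net_diagram \<Rightarrow> net_diagram" where
  "act A \<D> = \<lparr>lam1 = lin A (lam1 \<D>), lam2 = lin A (lam2 \<D>), mark = lin A (mark \<D>),
     drawn_lifts = (\<lambda>(s, e). (lin A s, lin A e)) ` drawn_lifts \<D>\<rparr>"

definition proj_class :: "net_diagram \<Rightarrow> net_diagram set" where
  "proj_class \<D> = {\<D>, act (- mat 1) \<D>}"

definition class_map :: "net_diagram set \<Rightarrow> (plane set \<Rightarrow> plane set) \<Rightarrow> bool" where
  "class_map C F \<longleftrightarrow> (\<exists>D. net_presentation D \<and> diagram_of D \<in> C \<and> corresponding_map D F)"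

definition A2_map :: "int^2^2 \<Rightarrow> plane set \<Rightarrow> plane set" where
  "A2_map A = induced int_lattice int_lattice (lin A)"

end

(*
  The induced map A_2 satisfies A_2 o id_bar = id_bar' o beta, where beta is the homeomorphism of
  S_1 onto S_1' induced by x |-> Ax, and beta o phi = phi'. Hence
  A_2 o F = id_bar' o (beta h beta^-1) o phi', and beta h beta^-1 is a push-point homeomorphism along
  the arcs of D', because the drawn lifts determine the arcs. It remains to see that two push-point
  homeomorphisms h, g along the same arcs differ by an isotopy rel P_1, even if they use different
  disks. Choose k moving the initial points of the arcs to the terminal ones and supported in the
  intersections of corresponding disks. Then k^-1 h and k^-1 g fix P_1 and are each supported in
  disjoint disks, so the Alexander trick makes both isotopic to the identity rel P_1.
*)
theory Submission
  imports Defs "HOL-Complex_Analysis.Conformal_Mappings"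
begin

section \<open>Isotopies\<close>

text \<open>\<open>closed_disk_in\<close> only says that a subset is homeomorphic to a closed disk
  in its subspace topology; it does not say how the boundary circle sits in the sphere. The
  Alexander trick needs the supported homeomorphism to fix that circle, and this is obtained from
  invariance of domain, which is why the quotients are equipped with charts. The intersection of two
  corresponding disks may be disconnected, while a homeomorphism supported there can push a point
  only within one component of its interior. The arc resolves this: it is connected and lies in the
  interior of both disks, so its two endpoints share a component. Equality of isotopy classes also
  asks both maps to be branched coverings. For \<open>F\<close> and \<open>F'\<close> this comes
  from explicit coordinates on the flat quotients, in which the projection is a power map. For
  \<open>A2_map A \<circ> F\<close> it is inherited from \<open>F'\<close> through the equation with
  \<open>F' \<circ> \<theta>\<close>. The hypothesis on projective classes relates the two
  presentations only up to sign, which is harmless because \<open>A\<close> and \<open>- A\<close>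
  induce the same map of the sphere.\<close>

lemma homeomorphic_map_cong:
  assumes "\<And>x. x \<in> topspace X \<Longrightarrow> f x = g x"
  shows "homeomorphic_map X Y f \<longleftrightarrow> homeomorphic_map X Y g"
  using assms homeomorphic_map_eq by metis

text \<open>\<open>homotopic_with\<close> controls its end maps only on the underlying space. With
  \<open>P\<close> inside that space, the condition of fixing \<open>P\<close> depends only on
  values there, so the usual description by one continuous map is available.\<close>

lemma isotopic_to_id_rel_iff:
  assumes "P \<subseteq> topspace X"
  shows "isotopic_to_id_rel X P \<theta> \<longleftrightarrow>
    (\<exists>h. continuous_map (prod_topology (top_of_set {0..1::real}) X) X h \<and>
       (\<forall>x\<in>topspace X. h (0, x) = x) \<and> (\<forall>x\<in>topspace X. h (1, x) = \<theta> x) \<and>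
       (\<forall>t\<in>{0..1}. homeomorphic_map X X (\<lambda>x. h (t, x)) \<and> (\<forall>p\<in>P. h (t, p) = p)))"
  unfolding isotopic_to_id_rel_def
proof (rule trans[OF homotopic_with], goal_cases)
  case (1 h k)
  then show ?case
    using assms homeomorphic_map_cong[of X h k X] by (auto simp: subset_iff)
qed auto

lemma isotopic_to_id_rel_cong:
  assumes "P \<subseteq> topspace X" "\<And>x. x \<in> topspace X \<Longrightarrow> f x = g x" "isotopic_to_id_rel X P f"
  shows "isotopic_to_id_rel X P g"
  using assms(2,3) unfolding isotopic_to_id_rel_iff[OF assms(1)] by auto

lemma isotopic_to_id_rel_id: "isotopic_to_id_rel X P id"
  unfolding isotopic_to_id_rel_def by simp

lemma isotopic_to_id_rel_imp:
  assumes "isotopic_to_id_rel X P f"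
  shows "homeomorphic_map X X f" "\<And>p. p \<in> P \<Longrightarrow> f p = p"
  using homotopic_with_imp_property[OF assms[unfolded isotopic_to_id_rel_def]] by auto

lemma isotopic_to_id_rel_compose:
  assumes f: "isotopic_to_id_rel X P f" and g: "isotopic_to_id_rel X P g"
  shows "isotopic_to_id_rel X P (f \<circ> g)"
proof -
  let ?Q = "\<lambda>f. homeomorphic_map X X f \<and> (\<forall>p\<in>P. f p = p)"
  have "homotopic_with ?Q X X (id \<circ> g) (f \<circ> g)"
    by (rule homotopic_with_compose_continuous_map_right[OF f[unfolded isotopic_to_id_rel_def]])
       (use isotopic_to_id_rel_imp[OF g] homeomorphic_map_compose homeomorphic_imp_continuous_map in auto)
  then show ?thesis
    using homotopic_with_trans[OF g[unfolded isotopic_to_id_rel_def]] by (simp add: isotopic_to_id_rel_def)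
qed

text \<open>Composing the isotopy from \<open>id\<close> to \<open>f\<close> with the fixed map
  \<open>g\<close> on the left gives an isotopy from \<open>g\<close> to \<open>id\<close>, which is
  then reversed. This avoids showing that inverses of the intermediate maps vary
  continuously.\<close>

lemma isotopic_to_id_rel_inverse:
  assumes f: "isotopic_to_id_rel X P f" and fg: "homeomorphic_maps X X f g" and P: "P \<subseteq> topspace X"
  shows "isotopic_to_id_rel X P g"
proof -
  let ?Q = "\<lambda>f. homeomorphic_map X X f \<and> (\<forall>p\<in>P. f p = p)"
  have g: "homeomorphic_map X X g" "\<forall>p\<in>P. g p = p" "\<And>x. x \<in> topspace X \<Longrightarrow> g (f x) = x"
  proof -
    show "homeomorphic_map X X g"
      using fg homeomorphic_maps_map by blast
    show gf: "\<And>x. x \<in> topspace X \<Longrightarrow> g (f x) = x"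
      using fg by (auto simp: homeomorphic_maps_def)
    show "\<forall>p\<in>P. g p = p"
      using gf P isotopic_to_id_rel_imp(2)[OF f] by (metis subsetD)
  qed
  have "homotopic_with ?Q X X (g \<circ> id) (g \<circ> f)"
    by (rule homotopic_with_compose_continuous_map_left[OF f[unfolded isotopic_to_id_rel_def]])
       (use g homeomorphic_map_compose homeomorphic_imp_continuous_map in auto)
  moreover have "homotopic_with ?Q X X (g \<circ> f) id"
    by (rule homotopic_with_equal)
       (use g isotopic_to_id_rel_imp[OF f] homeomorphic_map_compose[of X X f X g] homeomorphic_imp_continuous_map in auto)
  ultimately have "homotopic_with ?Q X X g id"
    using homotopic_with_trans[of ?Q X X "g \<circ> id" "g \<circ> f" id] by simp
  then show ?thesis
    unfolding isotopic_to_id_rel_def by (rule homotopic_with_symD)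
qed

lemma isotopic_to_id_rel_conjugate:
  assumes f: "isotopic_to_id_rel X P f" and ab: "homeomorphic_maps Y X a b"
    and P: "P \<subseteq> topspace X" and Q: "a ` Q \<subseteq> P" "Q \<subseteq> topspace Y"
  shows "isotopic_to_id_rel Y Q (b \<circ> f \<circ> a)"
proof -
  let ?P = "\<lambda>f. homeomorphic_map X X f \<and> (\<forall>p\<in>P. f p = p)"
  let ?Q = "\<lambda>f. homeomorphic_map Y Y f \<and> (\<forall>p\<in>Q. f p = p)"
  \<comment> \<open>After composition with \<open>b\<close> alone the maps go from \<open>X\<close>
    to \<open>Y\<close>, so fixing \<open>P\<close> becomes agreement with \<open>b\<close> on
    \<open>P\<close>.\<close>
  let ?R = "\<lambda>f. homeomorphic_map X Y f \<and> (\<forall>p\<in>P. f p = b p)"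
  have a: "homeomorphic_map Y X a" and b: "homeomorphic_map X Y b"
    and ba: "\<And>x. x \<in> topspace Y \<Longrightarrow> b (a x) = x"
    using ab by (auto simp: homeomorphic_maps_map)
  have "homotopic_with ?R X Y (b \<circ> id) (b \<circ> f)"
    by (rule homotopic_with_compose_continuous_map_left[OF f[unfolded isotopic_to_id_rel_def]])
       (use b homeomorphic_map_compose homeomorphic_imp_continuous_map in auto)
  then have "homotopic_with ?Q Y Y ((b \<circ> id) \<circ> a) ((b \<circ> f) \<circ> a)"
    by (rule homotopic_with_compose_continuous_map_right)
       (use a b ba Q homeomorphic_map_compose homeomorphic_imp_continuous_map in \<open>auto simp: image_subset_iff subset_iff\<close>)
  moreover have "homotopic_with ?Q Y Y id ((b \<circ> id) \<circ> a)"
    by (rule homotopic_with_equal) (use a b ba Q homeomorphic_map_compose[of Y X a Y b] in auto)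
  ultimately show ?thesis
    unfolding isotopic_to_id_rel_def using homotopic_with_trans by blast
qed

section \<open>Disks in surfaces\<close>

text \<open>The Hausdorff property makes disks and coincidence sets of continuous maps closed; the
  charts reduce questions about open sets to invariance of domain in the plane.\<close>

locale surface =
  fixes X :: "'a topology"
  assumes Hausdorff: "Hausdorff_space X"
    and chart: "\<And>x. x \<in> topspace X \<Longrightarrow> \<exists>U c. openin X U \<and> x \<in> U \<and>
      homeomorphic_map (subtopology X U) (top_of_set (ball (0::complex) 1)) c"
begin

lemma chart_maps:
  assumes "x \<in> topspace X"
  obtains U c d where "openin X U" "x \<in> U"
    "homeomorphic_maps (subtopology X U) (top_of_set (ball (0::complex) 1)) c d"
  using chart[OF assms] unfolding homeomorphic_map_maps by blast

text \<open>Openness is local: near each image point, a chart turns \<open>f\<close> into an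
  injective continuous map between planes.\<close>

lemma invariance_of_domain_into:
  fixes f :: "plane \<Rightarrow> 'a"
  assumes E: "open E" and f: "continuous_map (top_of_set E) X f" and inj: "inj_on f E"
  shows "openin X (f ` E)"
proof (subst openin_subopen, intro ballI)
  fix y assume y: "y \<in> f ` E"
  then have "y \<in> topspace X"
    using f by (auto simp: continuous_map_def)
  then obtain U c d where U: "openin X U" "y \<in> U"
    and cd: "homeomorphic_maps (subtopology X U) (top_of_set (ball (0::complex) 1)) c d"
    by (rule chart_maps)
  have UX: "U \<subseteq> topspace X"
    using U(1) by (rule openin_subset)
  define E' where "E' = {z\<in>E. f z \<in> U}"
  have "openin (top_of_set E) E'"
    using openin_continuous_map_preimage[OF f U(1)] by (simp add: E'_def)
  then have E': "open E'"
    using E openin_open_trans by blast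
  have c: "continuous_map (subtopology X U) euclidean c"
    and dc: "\<And>x. x \<in> U \<Longrightarrow> d (c x) = x"
    using cd UX by (auto simp: homeomorphic_maps_def continuous_map_in_subtopology subset_iff)
  have "continuous_map (top_of_set E') (subtopology X U) f"
    using continuous_map_from_subtopology_mono[OF f, of E']
    by (auto simp: E'_def continuous_map_in_subtopology)
  then have "continuous_on E' (c \<circ> f)"
    using continuous_map_compose[OF _ c] continuous_map_iff_continuous by blast
  moreover have "inj_on (c \<circ> f) E'"
    using inj dc by (intro inj_onI) (metis (mono_tags, lifting) E'_def comp_apply inj_onD mem_Collect_eq)
  ultimately have "open ((c \<circ> f) ` E')"
    by (intro invariance_of_domain_gen[OF E']) auto
  then have "openin (subtopology X U) {x \<in> topspace (subtopology X U). c x \<in> (c \<circ> f) ` E'}"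
    by (intro openin_continuous_map_preimage[OF c]) auto
  moreover have "{x \<in> topspace (subtopology X U). c x \<in> (c \<circ> f) ` E'} = f ` E'"
  proof -
    have "x \<in> f ` E'" if "x \<in> U" "c x = c (f z)" "z \<in> E'" for x z
    proof -
      have "f z \<in> U"
        using that by (simp add: E'_def)
      then have "x = f z"
        using that dc by metis
      then show ?thesis
        using that by blast
    qed
    moreover have "f ` E' \<subseteq> U"
      by (auto simp: E'_def)
    ultimately show ?thesis
      using UX by fastforce
  qed
  ultimately have "openin X (f ` E')"
    using U(1) openin_trans_full[of X U] by simp
  moreover have "y \<in> f ` E'" "f ` E' \<subseteq> f ` E"
    using y U(2) by (auto simp: E'_def)
  ultimately show "\<exists>T. openin X T \<and> y \<in> T \<and> T \<subseteq> f ` E"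
    by blast
qed

text \<open>The mirror image of the previous reduction: near each point of \<open>W\<close>,
  precomposition with an inverse chart gives an injective continuous map of an open set of the
  plane.\<close>

lemma invariance_of_domain_from:
  fixes u :: "'a \<Rightarrow> plane"
  assumes W: "openin X W" and u: "continuous_map (subtopology X W) euclidean u" and inj: "inj_on u W"
  shows "open (u ` W)"
proof (subst open_subopen, intro ballI)
  fix y assume "y \<in> u ` W"
  then obtain x where x: "x \<in> W" "y = u x" by blast
  have WX: "W \<subseteq> topspace X"
    using W by (rule openin_subset)
  with x obtain U c d where U: "openin X U" "x \<in> U"
    and cd: "homeomorphic_maps (subtopology X U) (top_of_set (ball (0::complex) 1)) c d"
    using chart_maps by (metis subsetD)
  have UX: "U \<subseteq> topspace X"
    using U(1) by (rule openin_subset)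
  define V where "V = c ` (U \<inter> W)"
  have "homeomorphic_map (subtopology X U) (top_of_set (ball (0::complex) 1)) c"
    using cd homeomorphic_map_maps by blast
  moreover have "openin (subtopology X U) (U \<inter> W)"
    using W by (simp add: openin_subtopology_Int2)
  ultimately have "openin (top_of_set (ball (0::complex) 1)) V"
    unfolding V_def by (meson homeomorphic_map_openness_eq)
  then have V: "open V"
    using openin_open_trans by blast
  have dc: "\<And>x. x \<in> U \<Longrightarrow> d (c x) = x"
    using cd UX by (auto simp: homeomorphic_maps_def)
  have "V \<subseteq> ball 0 1"
    using cd UX by (auto simp: V_def homeomorphic_maps_def continuous_map_def)
  moreover have "continuous_map (top_of_set (ball (0::complex) 1)) X d"
    using cd by (auto simp: homeomorphic_maps_def continuous_map_in_subtopology)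
  ultimately have "continuous_map (top_of_set V) (subtopology X W) d"
    using dc by (auto simp: V_def continuous_map_in_subtopology intro: continuous_map_from_subtopology_mono)
  then have "continuous_on V (u \<circ> d)"
    using continuous_map_compose[OF _ u] continuous_map_iff_continuous by blast
  moreover have "inj_on (u \<circ> d) V"
    using inj dc unfolding inj_on_def V_def by auto
  ultimately have "open ((u \<circ> d) ` V)"
    by (intro invariance_of_domain_gen[OF V]) auto
  moreover have "(u \<circ> d) ` V = u ` (U \<inter> W)"
    using dc by (simp add: V_def image_image)
  ultimately show "\<exists>T. open T \<and> y \<in> T \<and> T \<subseteq> u ` W"
    using x U by (intro exI[of _ "u ` (U \<inter> W)"]) auto
qed

end

text \<open>The Alexander isotopy, centred at \<open>c\<close> instead of the origin so that it keeps \<open>c\<close> fixed.\<close>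

definition shrink :: "plane \<Rightarrow> (plane \<Rightarrow> plane) \<Rightarrow> real \<Rightarrow> plane \<Rightarrow> plane" where
  "shrink c F t y = (if t = 0 then y else c + t *\<^sub>R (F (c + (1 / t) *\<^sub>R (y - c)) - c))"

lemma shrink_1: "shrink c F 1 = F"
  by (auto simp: shrink_def)

lemma shrink_centre: "F c = c \<Longrightarrow> shrink c F t c = c"
  by (auto simp: shrink_def)

lemma shrink_shrink: "(\<And>y. F (G y) = y) \<Longrightarrow> shrink c F t (shrink c G t y) = y"
  by (auto simp: shrink_def)

text \<open>\<open>y\<close> lies on the segment from \<open>c\<close> to the rescaled point
  \<open>?z\<close>. If \<open>?z\<close> were in the ball, convexity would put \<open>y\<close>
  there too; so \<open>F\<close> fixes \<open>?z\<close>. Convexity is what allows a centre other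
  than the origin.\<close>

lemma shrink_outside:
  assumes F: "\<And>y. y \<notin> ball 0 1 \<Longrightarrow> F y = y" and c: "norm c < 1" and t: "0 \<le> t" "t \<le> 1"
    and y: "y \<notin> ball 0 1"
  shows "shrink c F t y = y"
proof (cases "t = 0")
  case False
  let ?z = "c + (1 / t) *\<^sub>R (y - c)"
  have "y = (1 - t) *\<^sub>R c + t *\<^sub>R ?z"
    using False by (simp add: algebra_simps)
  then have "?z \<notin> ball 0 1"
    using convexD[OF convex_ball, of c 0 1 ?z "1 - t" t] c t y by fastforce
  then show ?thesis
    using False F by (simp add: shrink_def)
qed (simp add: shrink_def)

text \<open>The displacement at time \<open>t\<close> is \<open>t\<close> times a displacement of
  \<open>F\<close>, so it tends to 0 uniformly as \<open>t\<close> does.\<close>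

lemma norm_shrink_diff_le:
  assumes "\<And>y. norm (F y - y) \<le> K" "0 \<le> t"
  shows "norm (shrink c F t y - y) \<le> t * K"
proof (cases "t = 0")
  case False
  let ?z = "c + (1 / t) *\<^sub>R (y - c)"
  have "shrink c F t y - y = t *\<^sub>R (F ?z - ?z)"
    using False by (simp add: shrink_def algebra_simps)
  then show ?thesis
    using assms by (simp add: mult_left_mono)
qed (simp add: shrink_def)

text \<open>For positive times the formula is a composition of continuous maps. At time 0, where the
  formula switches, the displacement bound squeezes the distance to \<open>y\<close> below
  \<open>s * K + dist v y\<close>.\<close>

lemma continuous_on_shrink:
  assumes F: "continuous_on UNIV F" and K: "\<And>y. norm (F y - y) \<le> K"
  shows "continuous_on ({0..1} \<times> UNIV) (\<lambda>(t, y). shrink c F t y)"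
proof (unfold continuous_on_eq_continuous_within, intro ballI)
  fix z :: "real \<times> plane" assume z: "z \<in> {0..1} \<times> UNIV"
  obtain t y where ty: "z = (t, y)" by (cases z)
  show "continuous (at z within {0..1} \<times> UNIV) (\<lambda>(t, y). shrink c F t y)"
  proof (cases "t = 0")
    case True
    have "((\<lambda>z. fst z * K + dist (snd z) y) \<longlongrightarrow> fst (t, y) * K + dist (snd (t, y)) y)
        (at z within {0..1} \<times> UNIV)"
      unfolding ty by (intro tendsto_intros)
    then have lim: "((\<lambda>z. fst z * K + dist (snd z) y) \<longlongrightarrow> 0) (at z within {0..1} \<times> UNIV)"
      by (simp add: True)
    have "((\<lambda>(t, y). shrink c F t y) \<longlongrightarrow> y) (at z within {0..1} \<times> UNIV)"
    proof (rule metric_tendsto_imp_tendsto[OF lim], unfold eventually_at_filter, intro always_eventually allI impI)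
      fix w :: "real \<times> plane" assume "w \<noteq> z" "w \<in> {0..1} \<times> UNIV"
      then obtain s v where w: "w = (s, v)" "0 \<le> s" by auto
      have "norm (shrink c F s v - v) \<le> s * K"
        using norm_shrink_diff_le[OF K w(2)] .
      then have "dist (shrink c F s v) y \<le> s * K + dist v y"
        using dist_triangle[of "shrink c F s v" y v] by (simp add: dist_norm)
      then show "dist (case w of (t, y) \<Rightarrow> shrink c F t y) y \<le> dist (fst w * K + dist (snd w) y) 0"
        using w by (simp add: dist_real_def)
    qed
    then show ?thesis
      using True ty by (simp add: continuous_within shrink_def)
  next
    case False
    let ?S = "{0<..} \<times> UNIV :: (real \<times> plane) set"
    have "continuous_on ?S (\<lambda>z. c + fst z *\<^sub>R (F (c + (1 / fst z) *\<^sub>R (snd z - c)) - c))"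
      by (intro continuous_intros continuous_on_compose2[OF F]) auto
    then have "continuous_on ?S (\<lambda>(t, y). shrink c F t y)"
      by (rule continuous_on_cong[THEN iffD1, rotated -1]) (auto simp: shrink_def)
    moreover have "open ?S"
      by (intro open_Times) auto
    ultimately have "continuous (at z) (\<lambda>(t, y). shrink c F t y)"
      using False z ty by (simp add: continuous_on_eq_continuous_at)
    then show ?thesis
      by (rule continuous_at_imp_continuous_at_within)
  qed
qed

lemma inverse_fixes_outside:
  assumes "\<And>y. G (F y) = y" "\<And>y. y \<notin> S \<Longrightarrow> F y = y"
  shows "y \<notin> S \<Longrightarrow> G y = y"
  using assms by metis

text \<open>If \<open>F y\<close> lay outside the closed ball, \<open>F\<close> would fix
  \<open>F y\<close>, and injectivity would give \<open>F y = y\<close>.\<close>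

lemma ball_preserving:
  fixes F G :: "plane \<Rightarrow> plane"
  assumes FG: "\<And>y. F (G y) = y" "\<And>y. G (F y) = y" and F: "\<And>y. y \<notin> ball 0 1 \<Longrightarrow> F y = y"
    and y: "norm y \<le> 1"
  shows "norm (F y) \<le> 1"
proof (rule ccontr)
  assume "\<not> norm (F y) \<le> 1"
  moreover from this have "F (F y) = F y"
    by (intro F) auto
  then have "F y = y"
    using FG(2) by metis
  ultimately show False
    using y by simp
qed

section \<open>Homeomorphisms supported in one disk\<close>

definition extend_disk :: "'a set \<Rightarrow> ('a \<Rightarrow> plane) \<Rightarrow> (plane \<Rightarrow> 'a) \<Rightarrow> (plane \<Rightarrow> plane) \<Rightarrow> 'a \<Rightarrow> 'a" where
  "extend_disk B u v F x = (if x \<in> B then v (F (u x)) else x)"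

text \<open>\<open>u\<close> and \<open>v\<close> are mutually inverse coordinates for the subspace
  topology of \<open>B\<close>; how \<open>B\<close> sits inside \<open>X\<close> has to be deduced
  from the surface structure.\<close>

locale disk_in_surface = surface +
  fixes B :: "'a set" and u :: "'a \<Rightarrow> plane" and v :: "plane \<Rightarrow> 'a"
  assumes B_subset: "B \<subseteq> topspace X"
    and coords: "homeomorphic_maps (subtopology X B) (top_of_set (cball 0 1)) u v"
begin

lemma topspace_disk: "topspace (subtopology X B) = B"
  using B_subset by auto

lemma u_in: "x \<in> B \<Longrightarrow> norm (u x) \<le> 1"
proof -
  have "u ` B \<subseteq> cball 0 1"
    using homeomorphic_maps_imp_map[OF coords] homeomorphic_imp_surjective_map topspace_disk by fastforce
  then show "x \<in> B \<Longrightarrow> norm (u x) \<le> 1" by auto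
qed

lemma v_in: "norm y \<le> 1 \<Longrightarrow> v y \<in> B"
proof -
  have "homeomorphic_map (top_of_set (cball 0 1)) (subtopology X B) v"
    using coords homeomorphic_maps_map by blast
  then have "v ` cball 0 1 = B"
    using homeomorphic_imp_surjective_map topspace_disk by fastforce
  then show "norm y \<le> 1 \<Longrightarrow> v y \<in> B" by auto
qed

lemma vu: "x \<in> B \<Longrightarrow> v (u x) = x"
  using coords topspace_disk unfolding homeomorphic_maps_def by blast

lemma uv: "norm y \<le> 1 \<Longrightarrow> u (v y) = y"
  using coords by (simp add: homeomorphic_maps_def)

lemma continuous_u: "continuous_map (subtopology X B) euclidean u"
  using coords by (simp add: homeomorphic_maps_def continuous_map_in_subtopology)

lemma continuous_v: "continuous_map (top_of_set (cball 0 1)) X v"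
  using coords by (simp add: homeomorphic_maps_def continuous_map_in_subtopology)

lemma closedin_disk: "closedin X B"
proof -
  have "compactin (top_of_set (cball (0::plane) 1)) (cball 0 1)"
    by (simp add: compactin_subtopology)
  then have "compactin X (v ` cball 0 1)"
    using continuous_v image_compactin by blast
  moreover have "v ` cball 0 1 = B"
  proof (rule set_eqI)
    fix x
    have "x \<in> v ` cball 0 1" if "x \<in> B"
      using that vu[of x] u_in[of x] by (intro image_eqI[of _ _ "u x"]) auto
    then show "x \<in> v ` cball 0 1 \<longleftrightarrow> x \<in> B"
      using v_in by auto
  qed
  ultimately show ?thesis
    using compactin_imp_closedin[OF Hausdorff] by simp
qed

text \<open>Invariance of domain applied to \<open>v\<close> on the open unit disk. Hence every
  frontier point of \<open>B\<close> has a coordinate of norm 1.\<close>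

lemma openin_disk_interior: "openin X {x \<in> B. norm (u x) < 1}"
proof -
  have "openin X (v ` ball 0 1)"
  proof (rule invariance_of_domain_into)
    show "continuous_map (top_of_set (ball 0 1)) X v"
      using continuous_v ball_subset_cball by (rule continuous_map_from_subtopology_mono)
    show "inj_on v (ball 0 1)"
      using uv by (intro inj_on_inverseI[of _ u]) auto
  qed simp
  moreover have "v ` ball 0 1 = {x \<in> B. norm (u x) < 1}"
  proof (rule set_eqI)
    fix x
    have "x \<in> v ` ball 0 1" if "x \<in> B" "norm (u x) < 1"
      using that vu[of x] by (intro image_eqI[of _ _ "u x"]) auto
    moreover have "v y \<in> B \<and> norm (u (v y)) < 1" if "y \<in> ball 0 1" for y
      using that v_in[of y] uv[of y] by simp
    ultimately show "x \<in> v ` ball 0 1 \<longleftrightarrow> x \<in> {x \<in> B. norm (u x) < 1}"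
      by blast
  qed
  ultimately show ?thesis by simp
qed

lemma inj_on_u: "inj_on u B"
  using vu by (rule inj_on_inverseI)

lemma open_u_image: "openin X W \<Longrightarrow> W \<subseteq> B \<Longrightarrow> open (u ` W)"
  using invariance_of_domain_from continuous_map_from_subtopology_mono[OF continuous_u]
    inj_on_subset[OF inj_on_u] by metis

lemma norm_u_less:
  assumes "openin X W" "W \<subseteq> B" "x \<in> W"
  shows "norm (u x) < 1"
proof -
  have "u ` W \<subseteq> interior (cball 0 1)"
    using open_u_image assms u_in by (intro interior_maximal) auto
  then show ?thesis
    using assms(3) by auto
qed

text \<open>Pasting along the frontier of \<open>B\<close>, where the coordinate has norm 1 and
  \<open>H\<close> is the identity. The parameter space \<open>Z\<close> makes one statement serve
  both isotopies and single maps.\<close>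

lemma continuous_extend_disk:
  fixes Z :: "'c topology" and H :: "'c \<Rightarrow> plane \<Rightarrow> plane"
  assumes H: "continuous_map (prod_topology Z (top_of_set (cball 0 1))) euclidean (\<lambda>(t, y). H t y)"
    and H1: "\<And>t y. t \<in> topspace Z \<Longrightarrow> norm y \<le> 1 \<Longrightarrow> norm (H t y) \<le> 1"
    and H2: "\<And>t y. t \<in> topspace Z \<Longrightarrow> norm y = 1 \<Longrightarrow> H t y = y"
  shows "continuous_map (prod_topology Z X) X (\<lambda>(t, x). extend_disk B u v (H t) x)"
proof -
  let ?Y = "prod_topology Z X"
  have cl: "?Y closure_of {z. snd z \<in> B} \<subseteq> topspace Z \<times> B"
  proof -
    have "topspace ?Y \<inter> {z. snd z \<in> B} = topspace Z \<times> B"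
      using B_subset by auto
    moreover have "closedin ?Y (topspace Z \<times> B)"
      using closedin_disk by (simp add: closedin_prod_Times_iff)
    ultimately show ?thesis
      by (metis closure_of_closedin closure_of_restrict order_refl)
  qed
  have fr: "norm (u (snd z)) = 1" if "z \<in> ?Y frontier_of {z. snd z \<in> B}" for z
  proof -
    have z: "fst z \<in> topspace Z" "snd z \<in> B"
      using cl that by (auto simp: frontier_of_def)
    have "openin ?Y (topspace Z \<times> {x \<in> B. norm (u x) < 1})"
      using openin_disk_interior by (simp add: openin_prod_Times_iff)
    then have "topspace Z \<times> {x \<in> B. norm (u x) < 1} \<subseteq> ?Y interior_of {z. snd z \<in> B}"
      by (rule interior_of_maximal[rotated]) auto
    then have "\<not> norm (u (snd z)) < 1"
      using that z by (auto simp: frontier_of_def)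
    then show ?thesis
      using u_in z by fastforce
  qed
  have "continuous_map ?Y X (\<lambda>z. if snd z \<in> B then v (H (fst z) (u (snd z))) else snd z)"
  proof (rule continuous_map_cases)
    show "continuous_map (subtopology ?Y (?Y closure_of {z. snd z \<notin> B})) X snd"
      by (simp add: continuous_map_from_subtopology continuous_map_snd)
    show "v (H (fst z) (u (snd z))) = snd z" if "z \<in> ?Y frontier_of {z. snd z \<in> B}" for z
      using fr[OF that] cl that H2 vu by (auto simp: frontier_of_def)
    have "continuous_map (prod_topology Z (subtopology X B)) (prod_topology Z (top_of_set (cball 0 1))) (\<lambda>z. (fst z, u (snd z)))"
    proof (intro continuous_map_paired[THEN iffD2] conjI continuous_map_fst)
      have "continuous_map (subtopology X B) (top_of_set (cball 0 1)) u"
        using coords by (simp add: homeomorphic_maps_def)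
      from continuous_map_compose[OF continuous_map_snd this]
      show "continuous_map (prod_topology Z (subtopology X B)) (top_of_set (cball 0 1)) (\<lambda>z. u (snd z))"
        by (simp add: o_def)
    qed
    from continuous_map_compose[OF this H]
    have "continuous_map (prod_topology Z (subtopology X B)) (top_of_set (cball 0 1)) (\<lambda>z. H (fst z) (u (snd z)))"
      using H1 u_in by (auto simp: continuous_map_in_subtopology o_def)
    from continuous_map_compose[OF this continuous_v]
    have "continuous_map (prod_topology Z (subtopology X B)) X (\<lambda>z. v (H (fst z) (u (snd z))))"
      by (simp add: o_def)
    moreover have "prod_topology Z (subtopology X B) = subtopology ?Y (topspace Z \<times> B)"
      using subtopology_Times[of Z X "topspace Z" B] by simp
    ultimately have "continuous_map (subtopology ?Y (topspace Z \<times> B)) X (\<lambda>z. v (H (fst z) (u (snd z))))"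
      by simp
    then show "continuous_map (subtopology ?Y (?Y closure_of {z. snd z \<in> B})) X (\<lambda>z. v (H (fst z) (u (snd z))))"
      using cl by (rule continuous_map_from_subtopology_mono)
  qed
  then show ?thesis
    by (simp add: extend_disk_def case_prod_unfold)
qed

end

context disk_in_surface
begin

lemma continuous_extend_disk_const:
  assumes "continuous_on (cball 0 1) F" "\<And>y. norm y \<le> 1 \<Longrightarrow> norm (F y) \<le> 1" "\<And>y. norm y = 1 \<Longrightarrow> F y = y"
  shows "continuous_map X X (extend_disk B u v F)"
proof -
  \<comment> \<open>A one-point parameter space turns the parametrized pasting into a statement
    about a single map.\<close>
  let ?Z = "top_of_set {0::real}"
  have "continuous_map (top_of_set (cball 0 1)) euclidean F"
    using assms(1) continuous_map_iff_continuous by blast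
  then have "continuous_map (prod_topology ?Z (top_of_set (cball 0 1))) euclidean (F \<circ> snd)"
    using continuous_map_compose continuous_map_snd by blast
  then have "continuous_map (prod_topology ?Z (top_of_set (cball 0 1))) euclidean (\<lambda>(t, y). F y)"
    by (simp only: o_def case_prod_unfold)
  then have "continuous_map (prod_topology ?Z X) X (\<lambda>(t, x). extend_disk B u v F x)"
    by (rule continuous_extend_disk) (use assms in auto)
  moreover have "continuous_map X (prod_topology ?Z X) (Pair (0::real))"
    by (simp add: continuous_map_pairwise o_def)
  ultimately have "continuous_map X X ((\<lambda>(t, x). extend_disk B u v F x) \<circ> Pair (0::real))"
    using continuous_map_compose by blast
  then show ?thesis
    by (simp add: o_def)
qed

lemma homeomorphic_extend_disk:
  assumes "continuous_on UNIV F" "continuous_on UNIV G"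
    and FG: "\<And>y. F (G y) = y" "\<And>y. G (F y) = y" and F: "\<And>y. y \<notin> ball 0 1 \<Longrightarrow> F y = y"
  shows "homeomorphic_maps X X (extend_disk B u v F) (extend_disk B u v G)"
proof -
  have G: "\<And>y. y \<notin> ball 0 1 \<Longrightarrow> G y = y"
    using FG(2) F by (rule inverse_fixes_outside)
  have F1: "norm (F y) \<le> 1" if "norm y \<le> 1" for y
    using FG F that by (rule ball_preserving)
  have G1: "norm (G y) \<le> 1" if "norm y \<le> 1" for y
    using FG(2,1) G that by (rule ball_preserving)
  have "continuous_map X X (extend_disk B u v F)" "continuous_map X X (extend_disk B u v G)"
    using assms(1,2) F1 F G1 G by (auto intro!: continuous_extend_disk_const intro: continuous_on_subset)
  then show ?thesis
    unfolding homeomorphic_maps_def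
    using F1 G1 FG u_in v_in uv vu by (simp add: extend_disk_def)
qed

text \<open>The reverse of \<open>extend_disk\<close>: a self-map of \<open>B\<close> read in
  coordinates. It is extended by the identity to the whole plane because \<open>shrink\<close>
  evaluates its argument beyond the unit disk.\<close>

definition transport :: "('a \<Rightarrow> 'a) \<Rightarrow> plane \<Rightarrow> plane" where
  "transport f y = (if y \<in> cball 0 1 then u (f (v y)) else y)"

text \<open>Fixing the boundary circle makes the two pieces of \<open>transport\<close> agree where
  they meet. The bound 2 is the diameter of the unit disk; it supplies the constant \<open>K\<close>
  that \<open>shrink\<close> requires.\<close>

lemma transport:
  assumes f: "continuous_map X X f" and fB: "f ` B \<subseteq> B"
    and bd: "\<forall>x\<in>B. norm (u x) = 1 \<longrightarrow> f x = x"
  shows "continuous_on UNIV (transport f)"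
    and "y \<notin> ball 0 1 \<Longrightarrow> transport f y = y"
    and "norm (transport f y - y) \<le> 2"
    and "x \<in> B \<Longrightarrow> transport f (u x) = u (f x)"
proof -
  show out: "transport f y = y" if "y \<notin> ball 0 1" for y
    using that bd v_in[of y] uv[of y] by (auto simp: transport_def)
  show "norm (transport f y - y) \<le> 2"
  proof (cases "y \<in> cball 0 1")
    case True
    then have "norm (u (f (v y))) \<le> 1"
      using u_in v_in fB by auto
    then show ?thesis
      using True norm_triangle_ineq4[of "u (f (v y))" y] by (simp add: transport_def)
  qed (simp add: transport_def)
  show "x \<in> B \<Longrightarrow> transport f (u x) = u (f x)"
    using u_in vu by (simp add: transport_def)
  have "continuous_map (top_of_set (cball 0 1)) (subtopology X B) v"
    using coords by (simp add: homeomorphic_maps_def)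
  moreover have "continuous_map (subtopology X B) (subtopology X B) f"
    unfolding continuous_map_in_subtopology topspace_disk
    using continuous_map_from_subtopology[OF f] fB by (simp add: image_subset_iff_funcset)
  ultimately have "continuous_map (top_of_set (cball 0 1)) (subtopology X B) (f \<circ> v)"
    by (rule continuous_map_compose)
  then have "continuous_map (top_of_set (cball 0 1)) euclidean (u \<circ> (f \<circ> v))"
    using continuous_u by (rule continuous_map_compose)
  then have "continuous_on (cball 0 1) (\<lambda>y. u (f (v y)))"
    unfolding continuous_map_iff_continuous by (simp only: o_def)
  then have "continuous_on (cball 0 1 \<union> (- ball 0 1)) (\<lambda>y. if y \<in> cball 0 1 then u (f (v y)) else y)"
  proof (rule continuous_on_cases[OF closed_cball closed_Compl[OF open_ball] _ continuous_on_id])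
    show "\<forall>y. y \<in> cball 0 1 \<and> y \<notin> cball 0 1 \<or> y \<in> - ball 0 1 \<and> y \<in> cball 0 1 \<longrightarrow> u (f (v y)) = y"
    proof (intro allI impI)
      fix y :: plane assume "y \<in> cball 0 1 \<and> y \<notin> cball 0 1 \<or> y \<in> - ball 0 1 \<and> y \<in> cball 0 1"
      then show "u (f (v y)) = y"
        using out[of y] by (simp add: transport_def)
    qed
  qed
  moreover have "cball 0 1 \<union> (- ball 0 1) = (UNIV :: plane set)"
    by auto
  ultimately show "continuous_on UNIV (transport f)"
    unfolding transport_def by simp
qed

text \<open>The Alexander trick inside \<open>B\<close>, shrinking towards the coordinate of
  \<open>c\<close>. As \<open>c\<close> is the only point of \<open>P\<close> that can lie in
  \<open>B\<close>, keeping the centre fixed keeps all of \<open>P\<close> fixed.\<close>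

lemma isotopic_to_id_disk:
  assumes fg: "homeomorphic_maps X X f g" and fB: "f ` B = B"
    and bd: "\<forall>x\<in>B. norm (u x) = 1 \<longrightarrow> f x = x"
    and c: "c \<in> B" "norm (u c) < 1" "f c = c" and P: "P \<subseteq> topspace X" "P \<inter> B \<subseteq> {c}"
  shows "isotopic_to_id_rel X P (\<lambda>x. if x \<in> B then f x else x)"
proof -
  have f: "continuous_map X X f" and g: "continuous_map X X g"
    and gf: "\<And>x. x \<in> B \<Longrightarrow> g (f x) = x" and fgx: "\<And>x. x \<in> B \<Longrightarrow> f (g x) = x"
    using fg B_subset by (auto simp: homeomorphic_maps_def)
  have gB: "g ` B \<subseteq> B"
    using fB gf by (metis image_eqI image_subset_iff imageE)
  have fB': "f ` B \<subseteq> B"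
    using fB by simp
  have gbd: "\<forall>x\<in>B. norm (u x) = 1 \<longrightarrow> g x = x"
    using gf bd by metis
  note F = transport[OF f fB' bd] and G = transport[OF g gB gbd]
  have FG: "transport f (transport g y) = y" for y
  proof (cases "norm y \<le> 1")
    case True
    then show ?thesis
      using F(4)[of "g (v y)"] G(4)[of "v y"] v_in[of y] uv[of y] gB fgx[of "v y"] by auto
  qed (simp add: transport_def)
  have GF: "transport g (transport f y) = y" for y
  proof (cases "norm y \<le> 1")
    case True
    then show ?thesis
      using G(4)[of "f (v y)"] F(4)[of "v y"] v_in[of y] uv[of y] fB' gf[of "v y"] by auto
  qed (simp add: transport_def)
  \<comment> \<open>Shrinking \<open>transport g\<close> alongside \<open>transport f\<close>
    provides the inverse at each time, so every stage is a homeomorphism.\<close>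
  let ?c = "u c"
  let ?F = "shrink ?c (transport f)" and ?G = "shrink ?c (transport g)"
  have Fout: "?F t y = y" if "t \<in> {0..1}" "y \<notin> ball 0 1" for t y
    using shrink_outside[OF F(2) c(2)] that by auto
  have FGt: "?F t (?G t y) = y" "?G t (?F t y) = y" for t y
    using shrink_shrink[of "transport f" "transport g"] shrink_shrink[of "transport g" "transport f"] FG GF by auto
  have contF: "continuous_on ({0..1} \<times> UNIV) (\<lambda>(t, y). ?F t y)"
    using F(1,3) by (rule continuous_on_shrink)
  have contG: "continuous_on ({0..1} \<times> UNIV) (\<lambda>(t, y). ?G t y)"
    using G(1,3) by (rule continuous_on_shrink)
  have slice: "continuous_on UNIV (\<lambda>y. K t y)"
    if "continuous_on ({0..1} \<times> UNIV) (\<lambda>(t, y). K t y)" "t \<in> {0..1}" for K :: "real \<Rightarrow> plane \<Rightarrow> plane" and t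
    using continuous_on_o_Pair[OF that] by (simp add: o_def)
  have hom: "homeomorphic_maps X X (extend_disk B u v (?F t)) (extend_disk B u v (?G t))" if t: "t \<in> {0..1}" for t
    using slice[OF contF t] slice[OF contG t] FGt Fout[OF t] by (rule homeomorphic_extend_disk)
  have F1: "norm (?F t y) \<le> 1" if "t \<in> {0..1}" "norm y \<le> 1" for t y
    using FGt Fout[OF that(1)] that(2) by (rule ball_preserving)
  have "continuous_on ({0..1} \<times> cball 0 1) (\<lambda>(t, y). ?F t y)"
    using contF by (rule continuous_on_subset) auto
  then have "continuous_map (prod_topology (top_of_set {0..1}) (top_of_set (cball 0 1))) euclidean (\<lambda>(t, y). ?F t y)"
    using continuous_map_iff_continuous by (metis prod_topology_subtopology_eu)
  then have cont: "continuous_map (prod_topology (top_of_set {0..1}) X) X (\<lambda>(t, x). extend_disk B u v (?F t) x)"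
    by (rule continuous_extend_disk) (use F1 Fout in auto)
  have end1: "extend_disk B u v (?F 1) x = (if x \<in> B then f x else x)" for x
    using F(4)[of x] vu[of "f x"] fB by (auto simp: extend_disk_def shrink_1)
  have end0: "extend_disk B u v (?F 0) x = x" for x
    using vu by (auto simp: extend_disk_def shrink_def)
  have fixc: "extend_disk B u v (?F t) c = c" for t
    using c F(4)[OF c(1)] vu[OF c(1)] by (simp add: extend_disk_def shrink_centre)
  have "extend_disk B u v (?F t) p = p" if "p \<in> P" for t p
  proof (cases "p \<in> B")
    case True
    then have "p = c" using that P by auto
    then show ?thesis using fixc by simp
  qed (simp add: extend_disk_def)
  then show ?thesis
    unfolding isotopic_to_id_rel_iff[OF P(1)]
    using cont end0 end1 homeomorphic_maps_imp_map[OF hom]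
    by (intro exI[of _ "\<lambda>(t, x). extend_disk B u v (?F t) x"]) auto
qed

text \<open>The connected set \<open>u\<close>
  C\<open>lies in a single component\<close>S\<open>of the open set\<close>u \<open>W\<close>. A
  connected open subset of the plane admits a homeomorphism supported in it that carries one given
  point to another.\<close>

lemma homeomorphism_moving_in_disk:
  assumes W: "openin X W" "W \<subseteq> B" and C: "connectedin X C" "C \<subseteq> W" "a \<in> C" "b \<in> C"
  obtains k where "homeomorphic_map X X k" "\<And>x. x \<notin> W \<Longrightarrow> k x = x" "k a = b"
proof -
  define S where "S = connected_component_set (u ` W) (u a)"
  have "open (u ` W)"
    using W by (rule open_u_image)
  then have S: "open S" "S \<subseteq> u ` W" "connected S"
    unfolding S_def using open_connected_component connected_component_subset connected_connected_component by blast+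
  have "connectedin (subtopology X B) C"
    using C W by (auto simp: connectedin_subtopology)
  then have "connected (u ` C)"
    using connectedin_continuous_map_image[OF continuous_u] connectedin_iff_connected by blast
  then have "u ` C \<subseteq> S"
    unfolding S_def using C by (intro connected_component_maximal) auto
  then have ab: "u a \<in> S" "u b \<in> S"
    using C by auto
  \<comment> \<open>The moving-point theorem is relative to the affine hull of \<open>S\<close>,
    which is the plane since \<open>S\<close> is open and nonempty.\<close>
  then have aff: "affine hull S = UNIV"
    using affine_hull_open[OF S(1)] by auto
  obtain F G where FG: "homeomorphism UNIV UNIV F G" and Fab: "F (u a) = u b"
    and sub: "{x. \<not> (F x = x \<and> G x = x)} \<subseteq> S"
    by (rule homeomorphism_moving_point[of S UNIV "u a" "u b"]) (use S ab aff in auto)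
  have Sball: "S \<subseteq> ball 0 1"
    using S(2) norm_u_less[OF W] by auto
  have Fout: "F y = y" if "y \<notin> S" for y
    using sub that by blast
  have Fball: "F y = y" if "y \<notin> ball 0 1" for y
    using Fout Sball that by blast
  have "homeomorphic_maps X X (extend_disk B u v F) (extend_disk B u v G)"
    by (rule homeomorphic_extend_disk) (use FG Fball in \<open>auto simp: homeomorphism_def\<close>)
  moreover have "extend_disk B u v F x = x" if "x \<notin> W" for x
  proof (cases "x \<in> B")
    case True
    then have "u x \<notin> u ` W"
      using that W inj_on_u by (meson inj_on_image_mem_iff)
    then have "F (u x) = u x"
      using S(2) Fout by blast
    then show ?thesis
      using vu[OF True] by (simp add: extend_disk_def)
  qed (simp add: extend_disk_def)
  moreover have "extend_disk B u v F a = b"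
    using C W Fab vu[of b] by (auto simp: extend_disk_def)
  ultimately show ?thesis
    using that homeomorphic_map_maps by blast
qed

end

section \<open>Homeomorphisms supported in several disjoint disks\<close>

lemma (in surface) disk_in_surface_of:
  assumes "closed_disk_in X B"
  obtains u v where "disk_in_surface X B u v"
proof -
  obtain u v where "homeomorphic_maps (subtopology X B) (top_of_set (cball (0::plane) 1)) u v"
    using assms unfolding closed_disk_in_def homeomorphic_space_def by blast
  then have "disk_in_surface X B u v"
    using assms surface_axioms by (simp add: disk_in_surface_def disk_in_surface_axioms_def closed_disk_in_def)
  then show thesis by (rule that)
qed

text \<open>Induction on the disks that carry the support. The part \<open>f0\<close> of
  \<open>f\<close> in one disk is isotopic to the identity by the Alexander trick; undoing it with
  \<open>g0\<close> leaves a map supported in the remaining disks.\<close>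

lemma (in surface) isotopic_to_id_disks:
  assumes P: "P \<subseteq> topspace X" and disj: "disjoint_family_on B P"
    and B: "\<And>p. p \<in> P \<Longrightarrow> closed_disk_in X (B p) \<and> p \<in> X interior_of B p"
  shows "finite Q \<Longrightarrow> Q \<subseteq> P \<Longrightarrow> homeomorphic_map X X f \<Longrightarrow>
    (\<And>x. x \<in> topspace X - (\<Union>p\<in>Q. B p) \<Longrightarrow> f x = x) \<Longrightarrow> (\<And>p. p \<in> Q \<Longrightarrow> f ` B p = B p \<and> f p = p) \<Longrightarrow>
    isotopic_to_id_rel X P f"
proof (induction Q arbitrary: f rule: finite_induct)
  case empty
  then show ?case
    using isotopic_to_id_rel_cong[OF P _ isotopic_to_id_rel_id] by simp
next
  case (insert q Q)
  have qP: "q \<in> P" "Q \<subseteq> P"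
    using insert.prems by auto
  obtain u v where "disk_in_surface X (B q) u v"
    using B qP disk_in_surface_of by blast
  then interpret D: disk_in_surface X "B q" u v .
  obtain g where fg: "homeomorphic_maps X X f g"
    using insert.prems(2) homeomorphic_map_maps by blast
  have closed: "closedin X (B p)" if "p \<in> P" for p
    using B[OF that] disk_in_surface_of disk_in_surface.closedin_disk by blast
  have B_disj: "B p \<inter> B q = {}" if "p \<in> Q" for p
 proof -
    have "p \<noteq> q" "p \<in> P"
      using that insert.hyps qP by auto
    then show ?thesis
      using disj qP by (simp add: disjoint_family_on_def)
  qed
  have "f x = x" if x: "x \<in> B q" "norm (u x) = 1" for x
  proof (rule ccontr)
    assume "f x \<noteq> x"
    \<comment> \<open>This shows that \<open>f\<close> fixes the boundary circle: points that
      \<open>f\<close> moves outside the other disks form an open set, contained in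
      \<open>B q\<close>, so their coordinates have norm less than 1.\<close>
    let ?W = "topspace X - {x \<in> topspace X. f x = id x} - (\<Union>p\<in>Q. B p)"
    have "closedin X (\<Union>p\<in>Q. B p)"
      using insert.hyps(1) closed qP by (intro closedin_Union) auto
    moreover have "closedin X {x \<in> topspace X. f x = id x}"
      using insert.prems(2) 
      by (intro closedin_continuous_maps_eq[OF Hausdorff] homeomorphic_imp_continuous_map) (simp_all only: homeomorphic_map_id)
    ultimately have "openin X ?W"
      by (intro openin_diff) auto
    moreover have "?W \<subseteq> B q"
      using insert.prems(3) by auto
    moreover have "x \<in> ?W"
      using x \<open>f x \<noteq> x\<close> D.B_subset B_disj by auto
    ultimately have "norm (u x) < 1"
      by (rule D.norm_u_less)
    with x show False by simp
  qed
  then have bd: "\<forall>x\<in>B q. norm (u x) = 1 \<longrightarrow> f x = x"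
    by blast
  define f0 where "f0 = (\<lambda>x. if x \<in> B q then f x else x)"
  have q: "q \<in> X interior_of B q"
    using B qP by blast
  have "norm (u q) < 1"
    using q by (intro D.norm_u_less[of "X interior_of B q"]) (auto simp: interior_of_subset)
  moreover have "P \<inter> B q \<subseteq> {q}"
  proof
    fix p assume "p \<in> P \<inter> B q"
    moreover from this have "p \<in> B p"
      using B interior_of_subset by (metis IntD1 subsetD)
    ultimately show "p \<in> {q}"
      using disj qP by (auto simp: disjoint_family_on_def)
  qed
  moreover have "q \<in> B q"
    using q interior_of_subset by (metis subsetD)
  ultimately have f0: "isotopic_to_id_rel X P f0"
    unfolding f0_def using fg bd insert.prems(4) P by (intro D.isotopic_to_id_disk) auto
  then obtain g0 where g0: "homeomorphic_maps X X f0 g0"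
    using isotopic_to_id_rel_imp(1) homeomorphic_map_maps by blast
  have g0f0: "g0 (f0 x) = x" "f0 (g0 x) = x" if "x \<in> topspace X" for x
    using g0 that by (auto simp: homeomorphic_maps_def)
  have g0_id: "g0 x = x" if "x \<in> topspace X" "x \<notin> B q" for x
    using g0f0[of x] that by (simp add: f0_def)
  have f_in: "f x \<in> topspace X" if "x \<in> topspace X" for x
    using insert.prems(2) homeomorphic_imp_surjective_map that by fastforce
  have "isotopic_to_id_rel X P (g0 \<circ> f)"
  proof (rule insert.IH[OF qP(2)])
    show "homeomorphic_map X X (g0 \<circ> f)"
      using homeomorphic_map_compose insert.prems(2) g0 homeomorphic_maps_map by blast
    show "(g0 \<circ> f) x = x" if x: "x \<in> topspace X - (\<Union>p\<in>Q. B p)" for x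
    proof (cases "x \<in> B q")
      case True
      then show ?thesis
        using g0f0(1)[of x] x by (simp add: f0_def)
    next
      case False
      then show ?thesis
        using insert.prems(3)[of x] g0_id[of x] x by simp
    qed
    show "(g0 \<circ> f) ` B p = B p \<and> (g0 \<circ> f) p = p" if p: "p \<in> Q" for p
    proof -
      have "B p \<subseteq> topspace X"
        using closed p qP closedin_subset by blast
      then have g0p: "g0 x = x" if "x \<in> B p" for x
        using B_disj[OF p] that g0_id by blast
      have fp: "f ` B p = B p" "f p = p"
        using insert.prems(4) p by auto
      have "p \<in> B p"
        using B p qP interior_of_subset by (metis subsetD)
      then show ?thesis
        using fp g0p image_comp[of g0 f "B p"] by simp
    qed
  qed
  then have "isotopic_to_id_rel X P (f0 \<circ> (g0 \<circ> f))"
    by (rule isotopic_to_id_rel_compose[OF f0])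
  then show ?case
    by (rule isotopic_to_id_rel_cong[OF P, rotated]) (use g0f0(2) f_in in simp)
qed

lemma homeomorphic_map_id_outside_image:
  assumes k: "homeomorphic_map X X k" and W: "W \<subseteq> topspace X" and id: "\<And>x. x \<in> topspace X - W \<Longrightarrow> k x = x"
  shows "k ` W = W"
proof -
  have "k ` topspace X = topspace X" "inj_on k (topspace X)"
    using k homeomorphic_imp_surjective_map homeomorphic_imp_injective_map by blast+
  moreover have "k ` (topspace X - W) = topspace X - W"
    using id by simp
  ultimately show ?thesis
    using W inj_on_image_set_diff[of k "topspace X" "topspace X" "topspace X - W"]
    by (simp add: double_diff)
qed

text \<open>The points are moved one at a time. Each motion is supported in its own
  \<open>W p\<close>, so the disjoint supports keep it from disturbing the others.\<close>

lemma (in surface) homeomorphism_moving_points: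
  assumes disj: "disjoint_family_on W P"
    and W: "\<And>p. p \<in> P \<Longrightarrow> openin X (W p) \<and> closed_disk_in X (B p) \<and> W p \<subseteq> B p"
    and C: "\<And>p. p \<in> P \<Longrightarrow> connectedin X (C p) \<and> C p \<subseteq> W p \<and> p \<in> C p \<and> e p \<in> C p"
  shows "finite Q \<Longrightarrow> Q \<subseteq> P \<Longrightarrow> \<exists>k. homeomorphic_map X X k \<and> (\<forall>x. x \<notin> (\<Union>p\<in>Q. W p) \<longrightarrow> k x = x) \<and>
    (\<forall>p\<in>Q. k ` W p \<subseteq> W p \<and> k p = e p)"
proof (induction Q rule: finite_induct)
  case empty
  show ?case
    using homeomorphic_map_id by (intro exI[of _ id]) (auto simp: id_def)
next
  case (insert q Q)
  then have qP: "q \<in> P" "Q \<subseteq> P" by auto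
  with insert.IH obtain k where k: "homeomorphic_map X X k" "\<And>x. x \<notin> (\<Union>p\<in>Q. W p) \<Longrightarrow> k x = x"
    and kQ: "\<And>p. p \<in> Q \<Longrightarrow> k ` W p \<subseteq> W p \<and> k p = e p"
    by blast
  obtain u v where "disk_in_surface X (B q) u v"
    using W qP disk_in_surface_of by blast
  then interpret D: disk_in_surface X "B q" u v .
  obtain l where l: "homeomorphic_map X X l" "\<And>x. x \<notin> W q \<Longrightarrow> l x = x" "l q = e q"
    using W[OF qP(1)] C[OF qP(1)] D.homeomorphism_moving_in_disk by metis
  have disj': "W p \<inter> W q = {}" if "p \<in> Q" for p
 proof -
    have "p \<noteq> q" "p \<in> P"
      using that insert.hyps qP by auto
    then show ?thesis
      using disj qP by (simp add: disjoint_family_on_def)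
  qed
  have Wq: "k x = x" if "x \<in> W q" for x
    using k(2)[of x] that disj' by blast
  have WQ: "l x = x" if "x \<in> W p" "p \<in> Q" for x p
    using l(2)[of x] that disj' by blast
  have "l ` W q = W q"
    using homeomorphic_map_id_outside_image[OF l(1), of "W q"] l(2) W[OF qP(1)] openin_subset by blast
  then have q: "(l \<circ> k) ` W q \<subseteq> W q \<and> (l \<circ> k) q = e q"
    using Wq l(3) C[OF qP(1)] by auto
  have "(l \<circ> k) ` W p \<subseteq> W p \<and> (l \<circ> k) p = e p" if p: "p \<in> Q" for p
    using kQ[OF p] WQ[OF _ p] C[of p] qP p by auto
  moreover have "(l \<circ> k) x = x" if "x \<notin> (\<Union>p\<in>insert q Q. W p)" for x
    using that k(2) l(2) by auto
  moreover have "homeomorphic_map X X (l \<circ> k)"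
    using k(1) l(1) homeomorphic_map_compose by blast
  ultimately show ?case
    using q by (intro exI[of _ "l \<circ> k"]) blast
qed

text \<open>A push stripped of parametrizations: \<open>C\<close> gives the arcs as sets and
  \<open>e\<close> their terminal points. The disks \<open>B\<close> are an argument because pushes
  with different disks are compared.\<close>

definition push_along :: "'a topology \<Rightarrow> 'a set \<Rightarrow> ('a \<Rightarrow> 'a set) \<Rightarrow> ('a \<Rightarrow> 'a) \<Rightarrow> ('a \<Rightarrow> 'a set) \<Rightarrow> ('a \<Rightarrow> 'a) \<Rightarrow> bool" where
  "push_along X P C e B h \<longleftrightarrow> homeomorphic_map X X h \<and> disjoint_family_on B P \<and>
     (\<forall>x \<in> topspace X - (\<Union>p\<in>P. B p). h x = x) \<and>
     (\<forall>p\<in>P. closed_disk_in X (B p) \<and> C p \<subseteq> X interior_of B p \<and> h ` B p = B p \<and> h p = e p)"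

text \<open>The comparison map \<open>\<psi>\<close> stands to the right of \<open>h\<close> because
  \<open>same_isotopy_class_rel\<close> precomposes with the isotopy.\<close>

lemma (in surface) push_along_unique:
  assumes P: "finite P" "P \<subseteq> topspace X"
    and C: "\<And>p. p \<in> P \<Longrightarrow> connectedin X (C p) \<and> p \<in> C p \<and> e p \<in> C p"
    and h: "push_along X P C e B h" and h': "push_along X P C e B' h'"
  obtains \<psi> where "isotopic_to_id_rel X P \<psi>" "\<And>x. x \<in> topspace X \<Longrightarrow> h' x = h (\<psi> x)"
proof -
  \<comment> \<open>Both interiors contain the arc \<open>C p\<close>, so \<open>k\<close> can move
    \<open>p\<close> along it while respecting both families of disks.\<close>
  define W where "W p = X interior_of B p \<inter> X interior_of B' p" for p
  have WB: "W p \<subseteq> B p" "W p \<subseteq> B' p" for p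
    unfolding W_def using interior_of_subset by fast+
  have "disjoint_family_on W P"
    using h WB unfolding push_along_def disjoint_family_on_def by blast
  moreover have "openin X (W p) \<and> closed_disk_in X (B p) \<and> W p \<subseteq> B p" if "p \<in> P" for p
    using h that WB by (auto simp: push_along_def W_def)
  moreover have "connectedin X (C p) \<and> C p \<subseteq> W p \<and> p \<in> C p \<and> e p \<in> C p" if "p \<in> P" for p
    using C h h' that by (auto simp: push_along_def W_def)
  ultimately have "\<exists>k. homeomorphic_map X X k \<and> (\<forall>x. x \<notin> (\<Union>p\<in>P. W p) \<longrightarrow> k x = x) \<and>
      (\<forall>p\<in>P. k ` W p \<subseteq> W p \<and> k p = e p)"
    using P(1) order_refl by (rule homeomorphism_moving_points)
  then obtain k where k: "homeomorphic_map X X k" "\<And>x. x \<notin> (\<Union>p\<in>P. W p) \<Longrightarrow> k x = x"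
    and kW: "\<And>p. p \<in> P \<Longrightarrow> k ` W p \<subseteq> W p \<and> k p = e p"
    by blast
  obtain l where kl: "homeomorphic_maps X X k l"
    using k(1) homeomorphic_map_maps by blast
  have lk: "l (k x) = x" "k (l x) = x" if "x \<in> topspace X" for x
    using kl that by (auto simp: homeomorphic_maps_def)
  have l: "homeomorphic_map X X l"
    using kl homeomorphic_maps_map by blast
  \<comment> \<open>Stated for an arbitrary push \<open>f\<close> with disks \<open>D\<close> so
    that it applies to \<open>h\<close> and to \<open>h'\<close> alike.\<close>
  have main: "isotopic_to_id_rel X P (l \<circ> f)" if f: "push_along X P C e D f" and WD: "\<And>p. W p \<subseteq> D p" for f D
  proof (rule isotopic_to_id_disks[OF P(2) _ _ P(1) order_refl])
    show "disjoint_family_on D P"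
      using f by (simp add: push_along_def)
    show "closed_disk_in X (D p) \<and> p \<in> X interior_of D p" if "p \<in> P" for p
      using f C that unfolding push_along_def by blast
    show "homeomorphic_map X X (l \<circ> f)"
      using f l homeomorphic_map_compose by (auto simp: push_along_def)
    have l_id: "l x = x" if "x \<in> topspace X" "x \<notin> (\<Union>p\<in>P. W p)" for x
      using lk(1)[OF that(1)] k(2)[OF that(2)] by simp
    show "(l \<circ> f) x = x" if "x \<in> topspace X - (\<Union>p\<in>P. D p)" for x
    proof -
      have "x \<notin> (\<Union>p\<in>P. W p)"
        using that WD by blast
      then show ?thesis
        using f that l_id[of x] by (auto simp: push_along_def)
    qed
    show "(l \<circ> f) ` D p = D p \<and> (l \<circ> f) p = p" if p: "p \<in> P" for p
    proof -
      have Dp: "D p \<subseteq> topspace X"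
        using f p by (auto simp: push_along_def closed_disk_in_def)
      have D_eq: "q = p" if "q \<in> P" "x \<in> D q" "x \<in> D p" for q x
        using f p that unfolding push_along_def disjoint_family_on_def by blast
      \<comment> \<open>\<open>k\<close> moves points only within the sets \<open>W q\<close>, and
        for \<open>q \<noteq> p\<close> these lie in \<open>D q\<close>, which is disjoint from
        \<open>D p\<close>.\<close>
      have kD: "k ` D p \<subseteq> D p"
      proof
        fix y assume "y \<in> k ` D p"
        then obtain x where x: "x \<in> D p" "y = k x" by blast
        show "y \<in> D p"
        proof (cases "x \<in> W p")
          case True
          then show ?thesis
            using kW[OF p] WD x by blast
        next
          case False
          have "x \<notin> W q" if "q \<in> P" for q
            using False x(1) WD[of q] D_eq[OF that, of x] by blast
          then have "k x = x"
            by (intro k(2)) blast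
          then show ?thesis
            using x by simp
        qed
      qed
      have lD: "l ` D p \<subseteq> D p"
      proof
        fix x assume "x \<in> l ` D p"
        then obtain y where y: "y \<in> D p" "x = l y" by blast
        then have kx: "k x = y"
          using lk Dp by auto
        show "x \<in> D p"
        proof (cases "x \<in> (\<Union>q\<in>P. W q)")
          case True
          then obtain q where q: "q \<in> P" "x \<in> W q" by blast
          then have "y \<in> D q"
            using kW[OF q(1)] kx WD by blast
          then have "q = p"
            using y(1) q D_eq by blast
          then show ?thesis
            using q WD by blast
        next
          case False
          then show ?thesis
            using k(2) kx y by simp
        qed
      qed
      have "D p = l ` (k ` D p)"
        using lk(1) Dp by (force simp: image_image)
      then have "l ` D p = D p"
        using lD kD by blast
      moreover have "p \<in> topspace X"
        using p P by blast
      moreover have "f ` D p = D p" "f p = e p"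
        using f p by (auto simp: push_along_def)
      ultimately show ?thesis
        using kW[OF p] lk(1)[of p] image_comp[of l f "D p"] by simp
    qed
  qed
  have "isotopic_to_id_rel X P (l \<circ> h)" "isotopic_to_id_rel X P (l \<circ> h')"
    using main h h' WB by blast+
  moreover obtain g where g: "homeomorphic_maps X X (l \<circ> h) g"
    using isotopic_to_id_rel_imp(1)[OF calculation(1)] homeomorphic_map_maps by blast
  ultimately have "isotopic_to_id_rel X P (g \<circ> (l \<circ> h'))"
    using isotopic_to_id_rel_inverse P isotopic_to_id_rel_compose by blast
  \<comment> \<open>Here \<open>g\<close> inverts \<open>l \<circ> h\<close>. Cancelling
    \<open>l\<close> by applying \<open>k\<close> leaves the desired equation between
    \<open>h'\<close> and \<open>h\<close>.\<close>
  moreover have "h' x = h ((g \<circ> (l \<circ> h')) x)" if x: "x \<in> topspace X" for x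
  proof -
    have top: "h y \<in> topspace X" "h' y \<in> topspace X" "l y \<in> topspace X" "g y \<in> topspace X" if "y \<in> topspace X" for y
      using that h h' l g homeomorphic_maps_map[of X X "l \<circ> h" g]
      by (auto simp: push_along_def dest!: homeomorphic_imp_surjective_map)
    have "l (h (g (l (h' x)))) = l (h' x)"
      using g top x by (auto simp: homeomorphic_maps_def)
    then have "k (l (h (g (l (h' x))))) = k (l (h' x))"
      by simp
    then show ?thesis
      using lk(2) top x by simp
  qed
  ultimately show thesis
    by (rule that)
qed

section \<open>Quotients of the plane by lattices\<close>

lemma dist_int_lattice_ge_1:
  assumes "a \<in> int_lattice" "b \<in> int_lattice" "a \<noteq> b"
  shows "1 \<le> dist a b"
proof -
  obtain i where i: "a $ i \<noteq> b $ i"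
    using assms(3) by (auto simp: vec_eq_iff)
  have "a $ i - b $ i \<in> \<int>"
    using assms by (auto simp: int_lattice_def)
  then have "1 \<le> \<bar>a $ i - b $ i\<bar>"
    using i by (intro Ints_nonzero_abs_ge1) auto
  also have "\<dots> \<le> dist a b"
    using component_le_norm_cart[of "a - b" i] by (simp add: dist_norm)
  finally show ?thesis .
qed

text \<open>The sign \<open>s\<close> covers translations and point reflections at once, so orbit
  computations need no case split on the kind of group element.\<close>

lemma mem_proj: "y \<in> proj L x \<longleftrightarrow> (\<exists>l\<in>L. \<exists>s\<in>{1, -1::real}. y = 2 *\<^sub>R l + s *\<^sub>R x)"
  unfolding proj_def Gam_def by auto

locale integral_lattice =
  fixes L :: "plane set"
  assumes zero_mem: "0 \<in> L" and diff_mem: "a \<in> L \<Longrightarrow> b \<in> L \<Longrightarrow> a - b \<in> L"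
    and integral: "L \<subseteq> int_lattice"
begin

lemma minus_mem: "a \<in> L \<Longrightarrow> - a \<in> L"
  using diff_mem[OF zero_mem] by simp

lemma add_mem: "a \<in> L \<Longrightarrow> b \<in> L \<Longrightarrow> a + b \<in> L"
  using diff_mem[of a "- b"] minus_mem[of b] by simp

lemma sign_mem: "a \<in> L \<Longrightarrow> s \<in> {1, -1::real} \<Longrightarrow> s *\<^sub>R a \<in> L"
  using minus_mem by auto

lemma self_mem_proj: "x \<in> proj L x"
  unfolding mem_proj using zero_mem by (intro bexI[of _ 0] bexI[of _ 1]) auto

lemma proj_subset: "y \<in> proj L x \<Longrightarrow> proj L y \<subseteq> proj L x"
proof
  fix z assume "y \<in> proj L x" "z \<in> proj L y"
  then obtain l s m t where lm: "l \<in> L" "m \<in> L" and st: "s \<in> {1, -1::real}" "t \<in> {1, -1::real}"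
    and "y = 2 *\<^sub>R l + s *\<^sub>R x" "z = 2 *\<^sub>R m + t *\<^sub>R y"
    unfolding mem_proj by blast
  then have "z = 2 *\<^sub>R (m + t *\<^sub>R l) + (t * s) *\<^sub>R x"
    by (simp add: algebra_simps)
  moreover have "t * s \<in> {1, -1}" "m + t *\<^sub>R l \<in> L"
    using st lm by (auto intro!: add_mem sign_mem diff_mem)
  ultimately show "z \<in> proj L x"
    unfolding mem_proj by blast
qed

lemma proj_sym: "y \<in> proj L x \<Longrightarrow> x \<in> proj L y"
proof -
  assume "y \<in> proj L x"
  then obtain l s where l: "l \<in> L" and s: "s \<in> {1, -1::real}" and y: "y = 2 *\<^sub>R l + s *\<^sub>R x"
    unfolding mem_proj by blast
  have "x = 2 *\<^sub>R (- s *\<^sub>R l) + s *\<^sub>R y"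
    using s y by (auto simp: algebra_simps)
  moreover have "- s *\<^sub>R l \<in> L"
    using sign_mem[OF l, of "- s"] s by auto
  ultimately show ?thesis
    unfolding mem_proj using s by blast
qed

lemma proj_eq_iff: "proj L x = proj L y \<longleftrightarrow> y \<in> proj L x"
  using proj_subset proj_sym self_mem_proj by blast

lemma proj_affine: "l \<in> L \<Longrightarrow> s \<in> {1, -1::real} \<Longrightarrow> proj L (2 *\<^sub>R l + s *\<^sub>R x) = proj L x"
  using proj_eq_iff[of x] mem_proj by blast

text \<open>The group element that takes \<open>y\<close> to \<open>x\<close> is an isometry; it
  takes \<open>z\<close> to the required \<open>w\<close>.\<close>

lemma proj_imp_ball:
  assumes "proj L x = proj L y" "dist y z < r"
  obtains w where "proj L w = proj L z" "dist x w < r"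
proof -
  obtain l s where l: "l \<in> L" and s: "s \<in> {1, -1::real}" and x: "x = 2 *\<^sub>R l + s *\<^sub>R y"
    using assms(1) self_mem_proj mem_proj by metis
  show thesis
  proof (rule that)
    show "proj L (2 *\<^sub>R l + s *\<^sub>R z) = proj L z"
      using proj_affine[OF l s] .
    show "dist x (2 *\<^sub>R l + s *\<^sub>R z) < r"
      using assms(2) s x by (auto simp: dist_norm norm_minus_commute)
  qed
qed

text \<open>An orbit is the union of two translates of \<open>2L\<close>, and distinct points of one
  translate are at distance at least 2. Arbitrary subsets are allowed because an orbit with one
  point removed must also be closed.\<close>

lemma closed_subset_orbit:
  assumes "A \<subseteq> proj L x"
  shows "closed A"
proof -
  have cl: "closed (A \<inter> {2 *\<^sub>R l + c | l. l \<in> L})" for c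
  proof (rule discrete_imp_closed[of 1])
    show "\<forall>y\<in>A \<inter> {2 *\<^sub>R l + c | l. l \<in> L}. \<forall>z\<in>A \<inter> {2 *\<^sub>R l + c | l. l \<in> L}. dist z y < 1 \<longrightarrow> z = y"
    proof (intro ballI impI)
      fix y z assume "y \<in> A \<inter> {2 *\<^sub>R l + c | l. l \<in> L}" "z \<in> A \<inter> {2 *\<^sub>R l + c | l. l \<in> L}"
        and d: "dist z y < 1"
      then obtain l m where lm: "l \<in> L" "m \<in> L" and yz: "y = 2 *\<^sub>R l + c" "z = 2 *\<^sub>R m + c"
        by blast
      have "dist z y = 2 * dist m l"
        using norm_scaleR[of 2 "m - l"] by (simp add: yz dist_norm algebra_simps)
      then have "dist m l < 1"
        using d by simp
      then have "m = l"
        using dist_int_lattice_ge_1[of m l] lm integral by fastforce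
      then show "z = y"
        using yz by simp
    qed
  qed simp
  have "A = A \<inter> {2 *\<^sub>R l + x | l. l \<in> L} \<union> A \<inter> {2 *\<^sub>R l + - x | l. l \<in> L}"
    using assms unfolding subset_iff mem_proj by fastforce
  moreover have "closed (A \<inter> {2 *\<^sub>R l + x | l. l \<in> L} \<union> A \<inter> {2 *\<^sub>R l + - x | l. l \<in> L})"
    by (intro closed_Un cl)
  ultimately show ?thesis
    by simp
qed

lemma openin_proj_image:
  assumes "open U"
  shows "openin (qsphere L) (proj L ` U)"
  unfolding openin_qsphere
proof (intro conjI)
  show "open (proj L -` proj L ` U)"
  proof (rule openI)
    fix y assume "y \<in> proj L -` proj L ` U"
    then obtain x where x: "x \<in> U" "proj L x = proj L y"
      by auto
    obtain r where r: "r > 0" "ball x r \<subseteq> U"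
      using assms x(1) openE by blast
    have "ball y r \<subseteq> proj L -` proj L ` U"
    proof
      fix z assume "z \<in> ball y r"
      then obtain w where "proj L w = proj L z" "dist x w < r"
        using proj_imp_ball[OF x(2), of z r] by auto
      then show "z \<in> proj L -` proj L ` U"
        using r by (metis image_eqI mem_ball subsetD vimageI)
    qed
    then show "\<exists>r>0. ball y r \<subseteq> proj L -` proj L ` U"
      using r(1) by blast
  qed
qed auto

text \<open>The closed orbit of \<open>x\<close> misses a ball of radius \<open>d\<close> about
  \<open>y\<close>. If the images of the balls of radius \<open>d/2\<close> met, an isometry of the
  group would bring an orbit point of \<open>x\<close> within \<open>d\<close> of
  \<open>y\<close>.\<close>

lemma Hausdorff_qsphere: "Hausdorff_space (qsphere L)"
  unfolding Hausdorff_space_def topspace_qsphere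
proof (intro allI impI)
  fix p q assume "p \<in> range (proj L) \<and> q \<in> range (proj L) \<and> p \<noteq> q"
  then obtain x y where xy: "p = proj L x" "q = proj L y" "proj L x \<noteq> proj L y" by blast
  have "open (- proj L x)"
    using closed_subset_orbit[of "proj L x" x] by auto
  moreover have "y \<in> - proj L x"
    using xy proj_eq_iff by auto
  ultimately obtain d where d: "d > 0" "ball y d \<subseteq> - proj L x"
    using openE by blast
  have "disjnt (proj L ` ball x (d/2)) (proj L ` ball y (d/2))"
  proof (rule ccontr)
    assume "\<not> disjnt (proj L ` ball x (d/2)) (proj L ` ball y (d/2))"
    then obtain a b where ab: "dist x a < d/2" "dist y b < d/2" "proj L b = proj L a"
      by (fastforce simp: disjnt_def)
    obtain w where w: "proj L w = proj L x" "dist b w < d/2"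
      using proj_imp_ball[OF ab(3), of x "d/2"] ab(1) by (metis dist_commute)
    have "w \<in> proj L x"
      using w(1) self_mem_proj by metis
    moreover have "dist y w < d"
      using ab(2) w(2) dist_triangle[of y w b] by simp
    ultimately show False
      using d by auto
  qed
  then show "\<exists>U V. openin (qsphere L) U \<and> openin (qsphere L) V \<and> p \<in> U \<and> q \<in> V \<and> disjnt U V"
    using d xy openin_proj_image[of "ball x (d/2)"] openin_proj_image[of "ball y (d/2)"]
    by (intro exI[of _ "proj L ` ball x (d/2)"] exI[of _ "proj L ` ball y (d/2)"]) auto
qed

text \<open>The factor 2 makes the balls of radius \<open>r\<close> about distinct points of the
  orbit disjoint.\<close>

definition separated :: "plane \<Rightarrow> real \<Rightarrow> bool" where
  "separated x r \<longleftrightarrow> 0 < r \<and> (\<forall>w\<in>proj L x. dist w x < 2 * r \<longrightarrow> w = x)"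

lemma ex_separated: "\<exists>r. separated x r"
proof -
  have "open (- (proj L x - {x}))"
    by (intro open_Compl closed_subset_orbit[of _ x]) blast
  then obtain d where d: "d > 0" "ball x d \<subseteq> - (proj L x - {x})"
    using openE[of "- (proj L x - {x})" x] by blast
  then have "separated x (d/2)"
    by (auto simp: separated_def dist_commute subset_iff)
  then show ?thesis ..
qed

lemma separated_orbit:
  assumes "separated x r" "y \<in> proj L x"
  shows "separated y r"
  unfolding separated_def
proof (intro conjI ballI impI)
  show "0 < r"
    using assms by (simp add: separated_def)
  fix w assume w: "w \<in> proj L y" "dist w y < 2 * r"
  have "proj L x = proj L y"
    using assms(2) proj_eq_iff by blast
  obtain l s where l: "l \<in> L" and s: "s \<in> {1, -1::real}" and x: "x = 2 *\<^sub>R l + s *\<^sub>R y"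
    using proj_sym[OF assms(2)] unfolding mem_proj by blast
  have "proj L (2 *\<^sub>R l + s *\<^sub>R w) = proj L x"
    using proj_affine[OF l s, of w] w(1) proj_eq_iff[of y w] \<open>proj L x = proj L y\<close> by simp
  then have "2 *\<^sub>R l + s *\<^sub>R w \<in> proj L x"
    using self_mem_proj by metis
  moreover have "dist (2 *\<^sub>R l + s *\<^sub>R w) x < 2 * r"
    using w(2) s by (auto simp: x dist_norm norm_minus_commute)
  ultimately have "2 *\<^sub>R l + s *\<^sub>R w = x"
    using assms(1) by (auto simp: separated_def)
  then show "w = y"
    using x s by auto
qed

end

lemma integral_lattice_int_lattice: "integral_lattice int_lattice"
  by unfold_locales (auto simp: int_lattice_def)

section \<open>Complex coordinates near cone points\<close>

definition to_complex :: "plane \<Rightarrow> complex" where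
  "to_complex z = Complex (z $ 1) (z $ 2)"

lemma linear_to_complex: "linear to_complex"
  by (intro linearI) (auto simp: to_complex_def complex_eq_iff)

lemma norm_to_complex: "norm (to_complex z) = norm z"
  by (simp add: to_complex_def norm_vec_def L2_set_def sum_2 cmod_def)

lemma bij_to_complex: "bij to_complex"
proof (rule o_bij)
  show "(\<lambda>\<zeta>. vector [Re \<zeta>, Im \<zeta>]) \<circ> to_complex = id"
    by (auto simp: to_complex_def vec_eq_iff forall_2)
  show "to_complex \<circ> (\<lambda>\<zeta>. vector [Re \<zeta>, Im \<zeta>]) = id"
    by (auto simp: to_complex_def complex_eq_iff)
qed

text \<open>A local coordinate of the quotient at the image of \<open>w\<close>: here \<open>e\<close> is the order of the stabilizer
  of \<open>w\<close> in \<open>Gam L\<close>, and the sign \<open>s\<close> is needed to compare coordinates at different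
  points of an orbit.\<close>

definition cone_map :: "nat \<Rightarrow> real \<Rightarrow> plane \<Rightarrow> real \<Rightarrow> plane \<Rightarrow> complex" where
  "cone_map e s w r z = (to_complex (s *\<^sub>R (z - w)) / of_real r) ^ e"

lemma continuous_on_cone_map: "continuous_on A (cone_map e s w r)"
proof -
  have "continuous_on UNIV to_complex"
    using linear_to_complex by (rule linear_continuous_on_compose[OF continuous_on_id])
  moreover have "continuous_on A (\<lambda>z. s *\<^sub>R (z - w))"
    by (intro continuous_intros)
  ultimately have "continuous_on A (\<lambda>z. to_complex (s *\<^sub>R (z - w)))"
    by (rule continuous_on_compose2) simp
  then have "continuous_on A (\<lambda>z. to_complex (s *\<^sub>R (z - w)) * inverse (of_real r))"
    by (rule continuous_on_mult_right)
  then show ?thesis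
    unfolding cone_map_def divide_inverse by (rule continuous_on_power)
qed

lemma norm_cone_map:
  assumes "s \<in> {1, -1}" "r > 0"
  shows "norm (cone_map e s w r z) = (dist w z / r) ^ e"
  using assms by (auto simp: cone_map_def norm_power norm_divide norm_to_complex dist_norm norm_minus_commute)

text \<open>Invariance of domain treats the injective affine part, the open mapping theorem the
  power.\<close>

lemma open_cone_map_image:
  assumes "s \<in> {1, -1}" "r > 0" "e \<ge> 1" "open V"
  shows "open (cone_map e s w r ` V)"
proof -
  let ?g = "\<lambda>z. to_complex (s *\<^sub>R (z - w)) / of_real r"
  have "continuous_on V (cone_map 1 s w r)"
    by (rule continuous_on_cone_map)
  then have cont: "continuous_on V ?g"
    by (simp add: cone_map_def)
  have "inj ?g"
    using assms(1,2) bij_is_inj[OF bij_to_complex] by (intro injI) (auto simp: inj_eq)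
  then have "open (?g ` V)"
    using cont assms(4) by (intro invariance_of_domain_gen) (auto intro: inj_on_subset)
  moreover have "\<not> (\<lambda>\<zeta>::complex. \<zeta> ^ e) constant_on UNIV"
  proof
    assume "(\<lambda>\<zeta>::complex. \<zeta> ^ e) constant_on UNIV"
    then have "(0::complex) ^ e = 1 ^ e"
      unfolding constant_on_def by (metis UNIV_I)
    then show False
      using assms(3) by (simp add: power_0_left)
  qed
  ultimately have "open ((\<lambda>\<zeta>. \<zeta> ^ e) ` ?g ` V)"
    by (intro open_mapping_thm[of "\<lambda>\<zeta>::complex. \<zeta> ^ e" UNIV]) (auto intro!: holomorphic_intros)
  then show ?thesis
    by (simp add: image_image cone_map_def[abs_def])
qed

lemma cone_map_image_ball:
  assumes s: "s \<in> {1, -1}" and r: "r > 0" and e: "e \<in> {1, 2}"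
  shows "cone_map e s w r ` ball w r = ball 0 1"
proof
  show "cone_map e s w r ` ball w r \<subseteq> ball 0 1"
  proof (rule image_subsetI)
    fix z assume "z \<in> ball w r"
    then have "(dist w z / r) ^ e < 1"
      using r e by (auto simp: power_less_one_iff)
    then show "cone_map e s w r z \<in> ball 0 1"
      using norm_cone_map[OF s r, of e w z] by simp
  qed
  show "ball 0 1 \<subseteq> cone_map e s w r ` ball w r"
  proof
    fix \<zeta> :: complex assume \<zeta>: "\<zeta> \<in> ball 0 1"
    \<comment> \<open>For exponent 2 the root is a complex square root.\<close>
    obtain \<xi> where \<xi>: "\<xi> ^ e = \<zeta>"
      using e power2_csqrt[of \<zeta>] by (metis insertE power_one_right singletonD)
    obtain z' where z': "to_complex z' = of_real r * \<xi>"
      using bij_is_surj[OF bij_to_complex] by (metis surjD)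
    define z where "z = w + s *\<^sub>R z'"
    have eq: "cone_map e s w r z = \<zeta>"
      using s r z' \<xi> by (auto simp: cone_map_def z_def)
    have "(dist w z / r) ^ e < 1"
      using norm_cone_map[OF s r, of e w z] eq \<zeta> by simp
    then have "dist w z < r"
      using r e by (auto simp: power_less_one_iff)
    then show "\<zeta> \<in> cone_map e s w r ` ball w r"
      using eq by force
  qed
qed

text \<open>For \<open>e = 2\<close> squaring identifies opposite vectors from \<open>w\<close>, so
  the fibres are the pairs exchanged by the point reflection in \<open>w\<close>.\<close>

lemma cone_map_eq_iff:
  assumes s: "s \<in> {1, -1}" and r: "r > 0" and e: "e \<in> {1, 2}"
  shows "cone_map e s w r y = cone_map e s w r z \<longleftrightarrow> y = z \<or> e = 2 \<and> z = 2 *\<^sub>R w - y"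
proof -
  let ?g = "\<lambda>z. to_complex (s *\<^sub>R (z - w)) / of_real r"
  have inj: "?g a = ?g b \<longleftrightarrow> a = b" for a b
    using s r bij_is_inj[OF bij_to_complex] by (auto simp: inj_eq)
  have neg: "- ?g z = ?g (2 *\<^sub>R w - z)"
  proof -
    have "s *\<^sub>R (2 *\<^sub>R w - z - w) = - (s *\<^sub>R (z - w))"
      by (simp add: algebra_simps scaleR_2)
    then show ?thesis
      using linear_neg[OF linear_to_complex] by simp
  qed
  show ?thesis
  proof (cases "e = 2")
    case True
    have "y = 2 *\<^sub>R w - z \<longleftrightarrow> z = 2 *\<^sub>R w - y"
      by (auto simp: algebra_simps)
    then show ?thesis
      unfolding cone_map_def True power2_eq_iff neg inj by auto
  next
    case False
    then show ?thesis
      using e inj by (simp add: cone_map_def)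
  qed
qed

context integral_lattice
begin

text \<open>Nonzero translations fix no point and the reflection taking \<open>x\<close> to
  \<open>2 *\<^sub>R l - x\<close> fixes only \<open>l\<close>; so a nontrivial stabilizer occurs
  exactly at points of \<open>L\<close>.\<close>

definition cone_order :: "plane \<Rightarrow> nat" where
  "cone_order w = (if w \<in> L then 2 else 1)"

lemma cone_order_in: "cone_order w \<in> {1, 2}"
  by (simp add: cone_order_def)

lemma proj_reflect: "w \<in> L \<Longrightarrow> proj L (2 *\<^sub>R w - y) = proj L y"
  using proj_affine[of w "-1" y] by simp

text \<open>By \<open>sep\<close>, the fibres of the cone map on the ball are its intersections with
  orbits, so the map descends to an injective coordinate. Keeping \<open>sep\<close> as a hypothesis
  allows radii chosen for a larger lattice.\<close>

lemma ex_chart: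
  assumes s: "s \<in> {1, -1}" and r: "r > 0"
    and sep: "\<And>y z. y \<in> ball w r \<Longrightarrow> z \<in> ball w r \<Longrightarrow> proj L y = proj L z \<Longrightarrow>
      y = z \<or> w \<in> L \<and> z = 2 *\<^sub>R w - y"
  obtains u where
    "homeomorphic_map (subtopology (qsphere L) (proj L ` ball w r)) (top_of_set (ball 0 1)) u"
    "\<And>z. z \<in> ball w r \<Longrightarrow> u (proj L z) = cone_map (cone_order w) s w r z"
proof -
  let ?c = "cone_map (cone_order w) s w r" and ?U = "proj L ` ball w r"
  note e = cone_order_in[of w]
  define u where "u C = ?c (SOME z. z \<in> ball w r \<and> proj L z = C)" for C
  have c_eq: "?c y = ?c z \<longleftrightarrow> proj L y = proj L z" if "y \<in> ball w r" "z \<in> ball w r" for y z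
    using sep[OF that] proj_reflect[of w y]
    unfolding cone_map_eq_iff[OF s r e] by (auto simp: cone_order_def)
  have u: "u (proj L z) = ?c z" if "z \<in> ball w r" for z
  proof -
    have "(SOME y. y \<in> ball w r \<and> proj L y = proj L z) \<in> ball w r \<and>
        proj L (SOME y. y \<in> ball w r \<and> proj L y = proj L z) = proj L z"
      using that by (intro someI[where P = "\<lambda>y. y \<in> ball w r \<and> proj L y = proj L z"]) simp
    then show ?thesis
      unfolding u_def using c_eq[OF _ that] by blast
  qed
  have U: "openin (qsphere L) ?U"
    by (simp add: openin_proj_image)
  then have top: "topspace (subtopology (qsphere L) ?U) = ?U"
    using openin_subset by fastforce
  have u_image: "u ` ?U = ball 0 1"
    using u cone_map_image_ball[OF s r e, of w] by (simp add: image_image)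
  have "homeomorphic_map (subtopology (qsphere L) ?U) (top_of_set (ball 0 1)) u"
  proof (rule bijective_open_imp_homeomorphic_map)
    show "u ` topspace (subtopology (qsphere L) ?U) = topspace (top_of_set (ball 0 1))"
      using u_image top by simp
    show "inj_on u (topspace (subtopology (qsphere L) ?U))"
      unfolding top by (intro inj_onI) (use u c_eq in auto)
    have "continuous_map (subtopology (qsphere L) ?U) euclidean u"
      unfolding continuous_map_def top
    proof (intro conjI allI impI)
      fix T :: "complex set" assume "openin euclidean T"
      then have "open (?c -` T \<inter> ball w r)"
        using continuous_on_cone_map by (metis continuous_open_preimage Int_commute open_ball open_openin)
      then have "openin (qsphere L) (proj L ` (?c -` T \<inter> ball w r))"
        by (rule openin_proj_image)
      moreover have "{C \<in> ?U. u C \<in> T} = proj L ` (?c -` T \<inter> ball w r)"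
        using u by auto
      ultimately show "openin (subtopology (qsphere L) ?U) {C \<in> ?U. u C \<in> T}"
        using U by (auto simp: openin_open_subtopology)
    qed auto
    then show "continuous_map (subtopology (qsphere L) ?U) (top_of_set (ball 0 1)) u"
      using u_image top by (auto simp: continuous_map_in_subtopology)
    show "open_map (subtopology (qsphere L) ?U) (top_of_set (ball 0 1)) u"
      unfolding open_map_def
    proof (intro allI impI)
      fix V assume "openin (subtopology (qsphere L) ?U) V"
      then have V: "openin (qsphere L) V" "V \<subseteq> ?U"
        using U by (auto simp: openin_open_subtopology)
      have "open (proj L -` V \<inter> ball w r)"
        using V(1) by (intro open_Int) (auto simp: openin_qsphere)
      then have "open (?c ` (proj L -` V \<inter> ball w r))"
        using s r e by (intro open_cone_map_image) auto
      moreover have "u ` V = ?c ` (proj L -` V \<inter> ball w r)"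
      proof -
        have "V = proj L ` (proj L -` V \<inter> ball w r)"
          using V(2) by auto
        then have "u ` V = u ` proj L ` (proj L -` V \<inter> ball w r)"
          by simp
        also have "\<dots> = ?c ` (proj L -` V \<inter> ball w r)"
          unfolding image_image using u by (intro image_cong) auto
        finally show ?thesis .
      qed
      moreover have "u ` V \<subseteq> ball 0 1"
        using V(2) u_image by blast
      ultimately show "openin (top_of_set (ball 0 1)) (u ` V)"
        by (simp add: openin_open_eq)
    qed
  qed
  then show thesis
    using u that by blast
qed

end

text \<open>The element of \<open>Gam L\<close> taking \<open>y\<close> to \<open>z\<close> moves
  \<open>w\<close> by less than \<open>2 * r\<close>, hence fixes it, and so is the identity or the
  reflection in \<open>w\<close>. Since separation is measured in \<open>M\<close>, one radius
  serves both quotients.\<close>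

lemma separated_ball:
  assumes L: "integral_lattice L" and M: "integral_lattice M" and LM: "L \<subseteq> M"
    and w: "integral_lattice.separated M w r" and y: "y \<in> ball w r" and z: "z \<in> ball w r"
    and eq: "proj L y = proj L z"
  shows "y = z \<or> w \<in> L \<and> z = 2 *\<^sub>R w - y"
proof -
  interpret L: integral_lattice L by fact
  interpret M: integral_lattice M by fact
  obtain l s where l: "l \<in> L" and s: "s \<in> {1, -1::real}" and zy: "z = 2 *\<^sub>R l + s *\<^sub>R y"
    using eq L.self_mem_proj mem_proj by metis
  let ?w = "2 *\<^sub>R l + s *\<^sub>R w"
  have "dist ?w z = dist w y"
    using s by (auto simp: zy dist_norm norm_minus_commute)
  then have "dist ?w w < 2 * r"
    using y z dist_triangle[of ?w w z] by (simp add: dist_commute)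
  moreover have "?w \<in> proj M w"
    unfolding mem_proj using l s LM by blast
  ultimately have "?w = w"
    using w by (auto simp: M.separated_def)
  moreover have "a = b" if "(2::real) *\<^sub>R a = 2 *\<^sub>R b" for a b :: plane
    using that by simp
  ultimately show ?thesis
    using s zy l by (auto simp: algebra_simps simp flip: scaleR_2)
qed

lemma surface_qsphere:
  assumes "integral_lattice L"
  shows "surface (qsphere L)"
proof -
  interpret integral_lattice L by fact
  show ?thesis
  proof
    show "Hausdorff_space (qsphere L)"
      by (rule Hausdorff_qsphere)
    fix p assume "p \<in> topspace (qsphere L)"
    then obtain x where x: "p = proj L x"
      by (auto simp: topspace_qsphere)
    obtain r where r: "separated x r"
      using ex_separated by blast
    then have "r > 0"
      by (simp add: separated_def)
    then obtain u where "homeomorphic_map (subtopology (qsphere L) (proj L ` ball x r)) (top_of_set (ball (0::complex) 1)) u"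
      using ex_chart[of 1 r x] separated_ball[OF assms assms order_refl r] by blast
    then show "\<exists>U c. openin (qsphere L) U \<and> p \<in> U \<and>
        homeomorphic_map (subtopology (qsphere L) U) (top_of_set (ball (0::complex) 1)) c"
      using openin_proj_image[of "ball x r"] x \<open>r > 0\<close> by (intro exI[of _ "proj L ` ball x r"] exI[of _ u]) auto
  qed
qed

section \<open>Maps and branched coverings between lattice quotients\<close>

lemma continuous_map_induced:
  assumes L: "integral_lattice L" and M: "integral_lattice M" and T: "continuous_on UNIV T"
    and TL: "\<And>x y. proj L x = proj L y \<Longrightarrow> proj M (T x) = proj M (T y)"
  shows "induced L M T (proj L x) = proj M (T x)"
    and "continuous_map (qsphere L) (qsphere M) (induced L M T)"
proof -
  interpret L: integral_lattice L by fact
  show ind: "induced L M T (proj L x) = proj M (T x)" for x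
  proof (rule induced_proj[OF L.zero_mem])
    fix y assume "y \<in> proj L x"
    then show "proj M (T y) = proj M (T x)"
      using TL[of x y] L.proj_eq_iff by simp
  qed
  have "continuous_map euclidean euclidean T"
    using T by (simp add: continuous_map_iff_continuous2)
  then have "continuous_map euclidean (qsphere M) (proj M \<circ> T)"
    using quotient_imp_continuous_map[OF quotient_map_proj] continuous_map_compose by blast
  moreover have "proj M \<circ> T = induced L M T \<circ> proj L"
    using ind by auto
  ultimately show "continuous_map (qsphere L) (qsphere M) (induced L M T)"
    using continuous_compose_quotient_map[OF quotient_map_proj] by metis
qed

lemma homeomorphic_maps_induced:
  assumes L: "integral_lattice L" and M: "integral_lattice M"
    and T: "continuous_on UNIV T" and S: "continuous_on UNIV S"
    and ST: "\<And>x. S (T x) = x" and TS: "\<And>x. T (S x) = x"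
    and TL: "\<And>x y. proj L x = proj L y \<longleftrightarrow> proj M (T x) = proj M (T y)"
  shows "homeomorphic_maps (qsphere L) (qsphere M) (induced L M T) (induced M L S)"
proof -
  have SM: "proj L (S x) = proj L (S y)" if "proj M x = proj M y" for x y
    using that TL[of "S x" "S y"] TS by simp
  note T' = continuous_map_induced[OF L M T TL[THEN iffD1]]
  note S' = continuous_map_induced[OF M L S SM]
  show ?thesis
    unfolding homeomorphic_maps_def topspace_qsphere
    using T' S' ST TS by auto
qed

text \<open>Sheets and their coordinates are pulled back through \<open>k\<close>. Only pointwise
  agreement on the space is asked of \<open>g\<close>, which is what an isotopy equation
  supplies.\<close>

lemma branched_covering_compose_homeomorphism:
  assumes f: "branched_covering X Y f" and k: "homeomorphic_map W X k"
    and g: "\<And>x. x \<in> topspace W \<Longrightarrow> g x = f (k x)"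
  shows "branched_covering W Y g"
  unfolding branched_covering_def
proof (intro conjI ballI)
  have kW: "k ` topspace W = topspace X" and kc: "continuous_map W X k"
    using k homeomorphic_imp_surjective_map homeomorphic_imp_continuous_map by blast+
  note fc = f[unfolded branched_covering_def, THEN conjunct1]
    and fim = f[unfolded branched_covering_def, THEN conjunct2, THEN conjunct1]
    and fbr = f[unfolded branched_covering_def, THEN conjunct2, THEN conjunct2]
  have "continuous_map W Y (f \<circ> k)"
    using kc fc by (rule continuous_map_compose)
  then show "continuous_map W Y g"
    by (rule continuous_map_eq) (simp add: g)
  have "g ` topspace W = f ` k ` topspace W"
    unfolding image_image using g by (intro image_cong) auto
  then show "g ` topspace W = topspace Y"
    using fim kW by simp
  fix y assume "y \<in> topspace Y"
  then obtain V v \<U> where V: "openin Y V" "y \<in> V"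
    "homeomorphic_map (subtopology Y V) (top_of_set (ball (0::complex) 1)) v" "v y = 0"
    and \<U>: "\<forall>U\<in>\<U>. openin X U" "pairwise disjnt \<U>" "\<Union>\<U> = {x \<in> topspace X. f x \<in> V}"
    and u: "\<forall>U\<in>\<U>. \<exists>u k. homeomorphic_map (subtopology X U) (top_of_set (ball (0::complex) 1)) u \<and>
           k \<ge> (1::nat) \<and> (\<forall>x\<in>U. v (f x) = u x ^ k)"
    using fbr[THEN bspec, of y] by (elim meta_impE exE conjE) (assumption, rule that)
  let ?p = "\<lambda>U. {x \<in> topspace W. k x \<in> U}"
  show "\<exists>V v \<U>. openin Y V \<and> y \<in> V \<and>
      homeomorphic_map (subtopology Y V) (top_of_set (ball (0::complex) 1)) v \<and> v y = 0 \<and>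
      (\<forall>U\<in>\<U>. openin W U) \<and> pairwise disjnt \<U> \<and> \<Union>\<U> = {x \<in> topspace W. g x \<in> V} \<and>
      (\<forall>U\<in>\<U>. \<exists>u k. homeomorphic_map (subtopology W U) (top_of_set (ball (0::complex) 1)) u \<and>
         k \<ge> (1::nat) \<and> (\<forall>x\<in>U. v (g x) = u x ^ k))"
  proof (intro exI[of _ V] exI[of _ v] exI[of _ "?p ` \<U>"] conjI V ballI)
    show "pairwise disjnt (?p ` \<U>)"
    proof (rule pairwiseI)
      fix A B assume "A \<in> ?p ` \<U>" "B \<in> ?p ` \<U>" "A \<noteq> B"
      then obtain A' B' where AB: "A' \<in> \<U>" "B' \<in> \<U>" "A' \<noteq> B'" "A = ?p A'" "B = ?p B'"
        by blast
      then have "disjnt A' B'"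
        using \<U>(2) by (simp add: pairwise_def)
      then show "disjnt A B"
        using AB by (auto simp: disjnt_def)
    qed
    have "\<Union> (?p ` \<U>) = {x \<in> topspace W. k x \<in> \<Union>\<U>}"
      by blast
    moreover have "k x \<in> topspace X" if "x \<in> topspace W" for x
      using kW that by blast
    moreover have "k x \<in> \<Union>\<U> \<longleftrightarrow> k x \<in> topspace X \<and> f (k x) \<in> V" for x
      unfolding \<U>(3) by (rule mem_Collect_eq)
    ultimately show "\<Union> (?p ` \<U>) = {x \<in> topspace W. g x \<in> V}"
      using g by (simp only: cong: conj_cong) simp
    fix A assume "A \<in> ?p ` \<U>"
    then obtain U where U: "U \<in> \<U>" and A: "A = ?p U" by blast
    show "openin W A"
      unfolding A using kc \<U>(1)[THEN bspec, OF U] by (rule openin_continuous_map_preimage)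
    obtain u e where ue: "homeomorphic_map (subtopology X U) (top_of_set (ball (0::complex) 1)) u"
      "e \<ge> (1::nat)" "\<forall>x\<in>U. v (f x) = u x ^ e"
      using u[THEN bspec, OF U] by blast
    have "k ` (topspace W \<inter> A) = topspace X \<inter> U"
    proof -
      have "k ` {x \<in> topspace W. k x \<in> U} = k ` topspace W \<inter> U"
        by auto
      moreover have "topspace W \<inter> A = {x \<in> topspace W. k x \<in> U}"
        using A by auto
      ultimately show ?thesis
        using kW by simp
    qed
    then have "homeomorphic_map (subtopology W A) (subtopology X U) k"
      using k by (rule homeomorphic_map_subtopologies[rotated])
    then have "homeomorphic_map (subtopology W A) (top_of_set (ball (0::complex) 1)) (u \<circ> k)"
      using ue(1) by (rule homeomorphic_map_compose)
    moreover have "\<forall>x\<in>A. v (g x) = (u \<circ> k) x ^ e"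
      using ue(3) g by (simp add: A)
    ultimately show "\<exists>u k. homeomorphic_map (subtopology W A) (top_of_set (ball (0::complex) 1)) u \<and>
         k \<ge> (1::nat) \<and> (\<forall>x\<in>A. v (g x) = u x ^ k)"
      using ue(2) by blast
  qed
qed

text \<open>Over the image of a small ball about \<open>x\<close>, the sheets are the images in the
  \<open>L\<close>-quotient of the balls of the same radius about the points of the
  \<open>M\<close>-orbit of \<open>x\<close>. The local degree is the quotient of the two stabilizer
  orders.\<close>

lemma branched_covering_induced_id:
  assumes L: "integral_lattice L" and M: "integral_lattice M" and LM: "L \<subseteq> M"
  shows "branched_covering (qsphere L) (qsphere M) (induced L M id)"
  unfolding branched_covering_def
proof (intro conjI ballI)
  interpret L: integral_lattice L by fact
  interpret M: integral_lattice M by fact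
  have proj_LM: "proj M x = proj M y" if "proj L x = proj L y" for x y
  proof -
    have "y \<in> proj L x"
      using that L.proj_eq_iff by simp
    then have "y \<in> proj M x"
      using LM unfolding mem_proj by (meson subsetD)
    then show ?thesis
      using M.proj_eq_iff by simp
  qed
  have id: "continuous_on UNIV (id :: plane \<Rightarrow> plane)"
    by simp
  have id_LM: "proj M (id x) = proj M (id y)" if "proj L x = proj L y" for x y
    unfolding id_apply using that by (rule proj_LM)
  note cont = continuous_map_induced(2)[where T = id, OF L M id id_LM]
  have ind: "induced L M id (proj L x) = proj M x" for x
    using continuous_map_induced(1)[where T = id, OF L M id id_LM, of x] by (simp only: id_apply)
  show "continuous_map (qsphere L) (qsphere M) (induced L M id)"
    by (rule cont)
  show "induced L M id ` topspace (qsphere L) = topspace (qsphere M)"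
    unfolding topspace_qsphere by (simp add: image_image ind)
  fix y assume "y \<in> topspace (qsphere M)"
  then obtain x where x: "y = proj M x"
    by (auto simp: topspace_qsphere)
  obtain r where r: "M.separated x r"
    using M.ex_separated by blast
  then have r0: "r > 0"
    by (simp add: M.separated_def)
  obtain v where v: "homeomorphic_map (subtopology (qsphere M) (proj M ` ball x r)) (top_of_set (ball (0::complex) 1)) v"
    and vz: "\<And>z. z \<in> ball x r \<Longrightarrow> v (proj M z) = cone_map (M.cone_order x) 1 x r z"
    using M.ex_chart[of 1 r x] separated_ball[OF M M order_refl r] r0 by blast
  let ?V = "proj M ` ball x r" and ?B = "\<lambda>w. proj L ` ball w r"
  have sep: "M.separated w r" if "w \<in> proj M x" for w
    using M.separated_orbit r that by blast
  show "\<exists>V v \<U>. openin (qsphere M) V \<and> y \<in> V \<and>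
      homeomorphic_map (subtopology (qsphere M) V) (top_of_set (ball (0::complex) 1)) v \<and> v y = 0 \<and>
      (\<forall>U\<in>\<U>. openin (qsphere L) U) \<and> pairwise disjnt \<U> \<and>
      \<Union>\<U> = {c \<in> topspace (qsphere L). induced L M id c \<in> V} \<and>
      (\<forall>U\<in>\<U>. \<exists>u k. homeomorphic_map (subtopology (qsphere L) U) (top_of_set (ball (0::complex) 1)) u \<and>
         k \<ge> (1::nat) \<and> (\<forall>c\<in>U. v (induced L M id c) = u c ^ k))"
  proof (rule exI[of _ ?V], rule exI[of _ v], rule exI[of _ "?B ` proj M x"], intro conjI v ballI)
    show "openin (qsphere M) ?V"
      by (simp add: M.openin_proj_image)
    show "y \<in> ?V"
      using x r0 by simp
    have "linear to_complex"
      by (rule linear_to_complex)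
    then show "v y = 0"
      using x r0 vz[of x] by (simp add: cone_map_def linear_0 M.cone_order_def)
    show "pairwise disjnt (?B ` proj M x)"
    proof (rule pairwiseI)
      fix A B assume "A \<in> ?B ` proj M x" "B \<in> ?B ` proj M x" "A \<noteq> B"
      then obtain a b where ab: "a \<in> proj M x" "b \<in> proj M x" "A = ?B a" "B = ?B b" by blast
      show "disjnt A B"
      proof (rule ccontr)
        assume "\<not> disjnt A B"
        then obtain c d where cd: "dist a c < r" "dist b d < r" "proj L d = proj L c"
          unfolding ab disjnt_def by fastforce
        obtain l s where l: "l \<in> L" and s: "s \<in> {1, -1::real}" and d: "d = 2 *\<^sub>R l + s *\<^sub>R c"
          using cd(3) L.self_mem_proj mem_proj by metis
        \<comment> \<open>If two sheets meet, the group element taking \<open>c\<close> to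
          \<open>d\<close> brings \<open>a\<close> within \<open>2 * r\<close> of \<open>b\<close>.
          Both lie in one \<open>M\<close>-orbit, so separation makes them equal and the sheets
          coincide.\<close>
        let ?a = "2 *\<^sub>R l + s *\<^sub>R a"
        have "dist ?a d = dist a c"
          using s by (auto simp: d dist_norm norm_minus_commute)
        then have "dist ?a b < 2 * r"
          using cd dist_triangle[of ?a b d] by (simp add: dist_commute)
        moreover have "?a \<in> proj M b"
        proof -
          have "proj M ?a = proj M a"
            using M.proj_affine l LM s by blast
          then show ?thesis
            using ab(1,2) M.proj_eq_iff by metis
        qed
        ultimately have "?a = b"
          using sep[OF ab(2)] by (auto simp: M.separated_def)
        have "?B b \<subseteq> ?B a \<and> ?B a \<subseteq> ?B b"
        proof -
          have *: "?B q \<subseteq> ?B p" if pq: "proj L p = proj L q" for p q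
          proof (rule image_subsetI)
            fix z assume "z \<in> ball q r"
            then obtain w where "proj L w = proj L z" "dist p w < r"
              using L.proj_imp_ball[OF pq, of z r] by auto
            then show "proj L z \<in> ?B p"
              by (metis image_eqI mem_ball)
          qed
          have "proj L a = proj L b"
            using L.proj_affine[OF l s, of a] \<open>?a = b\<close> by simp
          then show ?thesis
            using *[of a b] *[of b a] by simp
        qed
        then show False
          using \<open>A \<noteq> B\<close> ab by blast
      qed
    qed
    show "\<Union> (?B ` proj M x) = {c \<in> topspace (qsphere L). induced L M id c \<in> ?V}"
    proof (intro equalityI subsetI)
      fix c assume "c \<in> \<Union> (?B ` proj M x)"
      then obtain w z where w: "w \<in> proj M x" and z: "dist w z < r" "c = proj L z"
        by auto
      obtain z' where "proj M z' = proj M z" "dist x z' < r"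
        using M.proj_imp_ball[of x w z r] w z M.proj_eq_iff by metis
      then have "proj M z \<in> ?V"
        by (metis image_eqI mem_ball)
      then show "c \<in> {c \<in> topspace (qsphere L). induced L M id c \<in> ?V}"
        using z ind by (simp add: topspace_qsphere)
    next
      fix c assume "c \<in> {c \<in> topspace (qsphere L). induced L M id c \<in> ?V}"
      then obtain z z' where z: "c = proj L z" "dist x z' < r" "proj M z = proj M z'"
        using ind by (auto simp: topspace_qsphere)
      obtain w where "proj M w = proj M x" "dist z w < r"
        using M.proj_imp_ball[OF z(3), of x r] z(2) by (metis dist_commute)
      then have "w \<in> proj M x" "z \<in> ball w r"
        using M.self_mem_proj by (auto simp: dist_commute)
      then show "c \<in> \<Union> (?B ` proj M x)"
        using z(1) by blast
    qed
    fix U assume "U \<in> ?B ` proj M x"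
    then obtain w where w: "w \<in> proj M x" and U: "U = ?B w" by blast
    show "openin (qsphere L) U"
      unfolding U by (simp add: L.openin_proj_image)
    obtain l s where l: "l \<in> M" and s: "s \<in> {1, -1::real}" and wx: "w = 2 *\<^sub>R l + s *\<^sub>R x"
      using w unfolding mem_proj by blast
    obtain u where u: "homeomorphic_map (subtopology (qsphere L) U) (top_of_set (ball (0::complex) 1)) u"
      and uz: "\<And>z. z \<in> ball w r \<Longrightarrow> u (proj L z) = cone_map (L.cone_order w) s w r z"
      using L.ex_chart[OF s r0, of w] separated_ball[OF L M LM sep[OF w]] unfolding U by blast
    \<comment> \<open>If \<open>w\<close> lies in \<open>L\<close>, then \<open>x\<close> lies in
      \<open>M\<close>; so the order upstairs divides the order downstairs.\<close>
    have order: "L.cone_order w * (M.cone_order x div L.cone_order w) = M.cone_order x"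
      "M.cone_order x div L.cone_order w \<ge> 1"
    proof -
      have "x \<in> M" if "w \<in> L"
      proof -
        have "x = s *\<^sub>R (w - (l + l))"
          using s wx by (auto simp: algebra_simps scaleR_2)
        then show ?thesis
          using that LM l s by (metis M.add_mem M.diff_mem M.sign_mem subsetD)
      qed
      then show "L.cone_order w * (M.cone_order x div L.cone_order w) = M.cone_order x"
        "M.cone_order x div L.cone_order w \<ge> 1"
        by (auto simp: L.cone_order_def M.cone_order_def)
    qed
    have "v (induced L M id (proj L z)) = u (proj L z) ^ (M.cone_order x div L.cone_order w)"
      if z: "z \<in> ball w r" for z
    proof -
      \<comment> \<open>The element taking \<open>x\<close> to \<open>w\<close> takes
        \<open>?z\<close> to \<open>z\<close>. Building the sign \<open>s\<close> into the chart at
        \<open>w\<close> makes the two affine coordinates equal before powers are taken.\<close>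
      let ?z = "s *\<^sub>R (z - 2 *\<^sub>R l)"
      have z_eq: "z = 2 *\<^sub>R l + s *\<^sub>R ?z"
        using s by auto
      have "dist x ?z = dist w z"
        using s by (auto simp: wx dist_norm norm_minus_commute algebra_simps)
      moreover have "proj M z = proj M ?z"
        using M.proj_affine[OF l s, of ?z] z_eq by simp
      moreover have "1 *\<^sub>R (?z - x) = s *\<^sub>R (z - w)"
        using s by (auto simp: wx algebra_simps)
      ultimately have "v (proj M z) = (to_complex (s *\<^sub>R (z - w)) / of_real r) ^ M.cone_order x"
        using vz[of ?z] z by (simp add: cone_map_def)
      then show ?thesis
        using uz[OF z] ind order(1) by (simp add: cone_map_def flip: power_mult)
    qed
    then show "\<exists>u k. homeomorphic_map (subtopology (qsphere L) U) (top_of_set (ball (0::complex) 1)) u \<and>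
         k \<ge> (1::nat) \<and> (\<forall>c\<in>U. v (induced L M id c) = u c ^ k)"
      using u order(2) unfolding U by blast
  qed
qed

section \<open>Maps of the flat spheres\<close>

lemma affine_mem_proj_iff:
  fixes A :: "plane \<Rightarrow> plane"
  assumes A: "linear A" "inj A" "A ` L = M" and b: "b \<in> M"
    and L: "integral_lattice L" and M: "integral_lattice M"
  shows "A y + b \<in> proj M (A x + b) \<longleftrightarrow> y \<in> proj L x"
proof -
  interpret L: integral_lattice L by fact
  interpret M: integral_lattice M by fact
  obtain k where k: "k \<in> L" "b = A k"
    using b A(3) by blast
  have mem: "A a \<in> M \<longleftrightarrow> a \<in> L" for a
    using A(2,3) by (metis inj_image_mem_iff)
  \<comment> \<open>Conjugating by the affine map leaves the vector \<open>l\<close> of a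
    translation alone, but shifts that of a reflection by \<open>k\<close>, because the translation
    term \<open>b = A k\<close> changes sign.\<close>
  have eq: "A y + b = 2 *\<^sub>R A (l + (if s = 1 then 0 else k)) + s *\<^sub>R (A x + b) \<longleftrightarrow> y = 2 *\<^sub>R l + s *\<^sub>R x"
    if "s \<in> {1, -1}" for l and s :: real
  proof -
    have "2 *\<^sub>R A (l + (if s = 1 then 0 else k)) + s *\<^sub>R (A x + b) = A (2 *\<^sub>R l + s *\<^sub>R x) + b"
      using that by (auto simp: k(2) linear_add[OF A(1)] linear_scale[OF A(1)] linear_diff[OF A(1)] vec_eq_iff linear_0[OF A(1)])
    then have "A y + b = 2 *\<^sub>R A (l + (if s = 1 then 0 else k)) + s *\<^sub>R (A x + b) \<longleftrightarrow> A y = A (2 *\<^sub>R l + s *\<^sub>R x)"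
      by simp
    also have "\<dots> \<longleftrightarrow> y = 2 *\<^sub>R l + s *\<^sub>R x"
      using A(2) by (simp add: inj_eq)
    finally show ?thesis .
  qed
  show ?thesis
  proof
    assume "A y + b \<in> proj M (A x + b)"
    then obtain m s where m: "m \<in> M" and s: "s \<in> {1, -1::real}" and y: "A y + b = 2 *\<^sub>R m + s *\<^sub>R (A x + b)"
      unfolding mem_proj by blast
    obtain l where l: "l \<in> L" "m = A l"
      using m A(3) by blast
    let ?l = "l - (if s = 1 then 0 else k)"
    have "y = 2 *\<^sub>R ?l + s *\<^sub>R x"
      using eq[OF s, of ?l] y l(2) by simp
    moreover have "?l \<in> L"
      using l k L.diff_mem by simp
    ultimately show "y \<in> proj L x"
      unfolding mem_proj using s by blast
  next
    assume "y \<in> proj L x"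
    then obtain l s where l: "l \<in> L" and s: "s \<in> {1, -1::real}" and y: "y = 2 *\<^sub>R l + s *\<^sub>R x"
      unfolding mem_proj by blast
    have "A y + b = 2 *\<^sub>R A (l + (if s = 1 then 0 else k)) + s *\<^sub>R (A x + b)"
      using eq[OF s] y by blast
    moreover have "A (l + (if s = 1 then 0 else k)) \<in> M"
      unfolding mem using l k L.add_mem by simp
    ultimately show "A y + b \<in> proj M (A x + b)"
      unfolding mem_proj using s by blast
  qed
qed

text \<open>Serves twice: for \<open>phi\<close>, with translation \<open>mark D\<close>, and for
  the homeomorphism between the two \<open>sphere1\<close> spaces induced by the matrix, with
  translation 0.\<close>

lemma homeomorphic_maps_affine:
  fixes N :: "real^2^2"
  assumes L: "integral_lattice L" and M: "integral_lattice M"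
    and N: "det N \<noteq> 0" "(*v) N ` L = M" and b: "b \<in> M" and T: "\<And>x. T x = N *v x + b"
  obtains g where "homeomorphic_maps (qsphere L) (qsphere M) (induced L M T) g"
    and "\<And>x. induced L M T (proj L x) = proj M (T x)"
    and "induced L M T ` cone_points L = cone_points M"
proof -
  interpret L: integral_lattice L by fact
  interpret M: integral_lattice M by fact
  have inv: "invertible N"
    using N(1) by (simp add: invertible_det_nz)
  then have inj: "inj ((*v) N)"
    by (simp add: inj_matrix_vector_mult)
  obtain N' where N': "N ** N' = mat 1" "N' ** N = mat 1"
    using inv by (auto simp: invertible_def)
  let ?S = "\<lambda>y. N' *v (y - b)"
  have ST: "?S (T x) = x" for x
    using N' by (simp add: T matrix_vector_mul_assoc)
  have TS: "T (?S y) = y" for y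
    using N' by (simp add: T matrix_vector_mul_assoc)
  have cT: "continuous_on UNIV T"
    unfolding T[abs_def] by (intro continuous_intros matrix_vector_mult_linear_continuous_on)
  have cS: "continuous_on UNIV ?S"
    by (intro continuous_on_compose2[OF matrix_vector_mult_linear_continuous_on[of UNIV N']] continuous_intros) auto
  have TL: "proj L x = proj L y \<longleftrightarrow> proj M (T x) = proj M (T y)" for x y
    unfolding L.proj_eq_iff M.proj_eq_iff T
    using affine_mem_proj_iff[OF matrix_vector_mul_linear inj N(2) b L M] by simp
  have TM: "T ` L = M"
  proof
    show "T ` L \<subseteq> M"
      using N(2) b M.add_mem by (auto simp: T)
    show "M \<subseteq> T ` L"
    proof
      fix m assume "m \<in> M"
      then obtain l where "l \<in> L" "m - b = N *v l"
        using N(2) b M.diff_mem by (metis imageE)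
      then show "m \<in> T ` L"
        by (intro image_eqI[of _ _ l]) (auto simp: T algebra_simps)
    qed
  qed
  show thesis
  proof (rule that)
    show ind: "induced L M T (proj L x) = proj M (T x)" for x
      using continuous_map_induced(1)[OF L M cT TL[THEN iffD1]] .
    show "homeomorphic_maps (qsphere L) (qsphere M) (induced L M T) (induced M L ?S)"
      using homeomorphic_maps_induced[OF L M cT cS ST TS TL] .
    have "induced L M T ` proj L ` L = proj M ` T ` L"
      by (simp only: image_image ind)
    then show "induced L M T ` cone_points L = cone_points M"
      using TM by (simp add: cone_points_def)
  qed
qed

lemma basis_matrix_mult: "basis_matrix D *v x = x $ 1 *\<^sub>R lam1 D + x $ 2 *\<^sub>R lam2 D"
  by (simp add: basis_matrix_def vec_eq_iff matrix_vector_mult_def sum_2 transpose_def mult.commute)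

lemma lattice1_eq_image: "lattice1 D = (*v) (basis_matrix D) ` int_lattice"
proof (intro equalityI subsetI)
  fix x assume "x \<in> lattice1 D"
  then obtain m n :: int where x: "x = of_int m *\<^sub>R lam1 D + of_int n *\<^sub>R lam2 D"
    by (auto simp: lattice1_def)
  let ?z = "vector [of_int m, of_int n] :: plane"
  have "?z \<in> int_lattice"
    by (simp add: int_lattice_def forall_2)
  moreover have "x = basis_matrix D *v ?z"
    by (simp add: basis_matrix_mult x)
  ultimately show "x \<in> (*v) (basis_matrix D) ` int_lattice"
    by blast
next
  fix x assume "x \<in> (*v) (basis_matrix D) ` int_lattice"
  then obtain z where z: "z \<in> int_lattice" "x = basis_matrix D *v z"
    by blast
  obtain m n where "z $ 1 = of_int m" "z $ 2 = of_int n"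
    using z(1) unfolding int_lattice_def by (metis (mono_tags, lifting) Ints_cases mem_Collect_eq)
  then have "x = of_int m *\<^sub>R lam1 D + of_int n *\<^sub>R lam2 D"
    using z(2) by (simp add: basis_matrix_mult)
  then show "x \<in> lattice1 D"
    unfolding lattice1_def by blast
qed

lemma integral_lattice_lattice1:
  assumes "lattice1 D \<subseteq> int_lattice"
  shows "integral_lattice (lattice1 D)"
proof
  interpret Z: integral_lattice int_lattice
    by (rule integral_lattice_int_lattice)
  show "0 \<in> lattice1 D"
    unfolding lattice1_eq_image using Z.zero_mem by (intro image_eqI[of _ _ 0]) auto
  show "a - b \<in> lattice1 D" if ab: "a \<in> lattice1 D" "b \<in> lattice1 D" for a b
  proof -
    obtain x y where "x \<in> int_lattice" "y \<in> int_lattice" "a = basis_matrix D *v x" "b = basis_matrix D *v y"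
      using ab unfolding lattice1_eq_image by blast
    then show ?thesis
      unfolding lattice1_eq_image using Z.diff_mem by (intro image_eqI[of _ _ "x - y"]) (auto simp: matrix_vector_mult_diff_distrib)
  qed
qed (use assms in auto)

text \<open>Translations by twice the lattice reduce both coefficients modulo 2, leaving at most
  four classes.\<close>

lemma finite_P1:
  assumes "lattice1 D \<subseteq> int_lattice"
  shows "finite (P1 D)"
proof -
  interpret integral_lattice "lattice1 D"
    using assms by (rule integral_lattice_lattice1)
  have "P1 D \<subseteq> (\<lambda>(m, n). proj1 D (of_int m *\<^sub>R lam1 D + of_int n *\<^sub>R lam2 D)) ` ({0, 1} \<times> {0, 1::int})"
  proof
    fix p assume "p \<in> P1 D"
    then obtain m n :: int where p: "p = proj1 D (of_int m *\<^sub>R lam1 D + of_int n *\<^sub>R lam2 D)"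
      by (auto simp: cone_points_def lattice1_def)
    let ?l = "of_int (m div 2) *\<^sub>R lam1 D + of_int (n div 2) *\<^sub>R lam2 D"
      and ?w = "of_int (m mod 2) *\<^sub>R lam1 D + of_int (n mod 2) *\<^sub>R lam2 D"
    have mod_eq: "real_of_int k = 2 * of_int (k div 2) + of_int (k mod 2)" for k
      by (metis mult_div_mod_eq of_int_add of_int_mult of_int_numeral)
    have "of_int m *\<^sub>R lam1 D + of_int n *\<^sub>R lam2 D = 2 *\<^sub>R ?l + 1 *\<^sub>R ?w"
      by (subst mod_eq[of m], subst mod_eq[of n]) (simp add: algebra_simps)
    moreover have "?l \<in> lattice1 D"
      unfolding lattice1_def by blast
    ultimately have "p = proj1 D ?w"
      unfolding p using proj_affine[of ?l 1 ?w] by simp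
    moreover have "(m mod 2, n mod 2) \<in> {0, 1} \<times> {0, 1}"
    proof -
      have "k mod 2 = 0 \<or> k mod 2 = 1" for k :: int
        by presburger
      then show ?thesis
        by auto
    qed
    ultimately show "p \<in> (\<lambda>(m, n). proj1 D (of_int m *\<^sub>R lam1 D + of_int n *\<^sub>R lam2 D)) ` ({0, 1} \<times> {0, 1::int})"
      by (intro image_eqI[of _ _ "(m mod 2, n mod 2)"]) simp_all
  qed
  then show ?thesis
    by (rule finite_subset) auto
qed

text \<open>Disks are carried along by \<open>a\<close> and reindexed through \<open>b\<close>. The
  target data \<open>C'\<close> and \<open>e'\<close> are prescribed, not defined by transport,
  because they will be the arcs of the second presentation.\<close>

lemma push_along_conjugate:
  assumes h: "push_along X P C e B h" and ab: "homeomorphic_maps X Y a b" and P: "P \<subseteq> topspace X"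
    and C': "\<And>p. p \<in> P \<Longrightarrow> C' (a p) = a ` C p \<and> e' (a p) = a (e p)"
    and C: "\<And>p. p \<in> P \<Longrightarrow> C p \<subseteq> topspace X"
  shows "push_along Y (a ` P) C' e' (\<lambda>q. a ` B (b q)) (a \<circ> h \<circ> b)"
proof -
  have a: "homeomorphic_map X Y a" and b: "homeomorphic_map Y X b"
    using ab homeomorphic_maps_map by blast+
  have ba: "b (a x) = x" if "x \<in> topspace X" for x
    using ab that by (simp add: homeomorphic_maps_def)
  have aby: "a (b y) = y" "b y \<in> topspace X" if "y \<in> topspace Y" for y
    using ab that homeomorphic_imp_surjective_map[OF b] by (auto simp: homeomorphic_maps_def)
  have inj: "inj_on a (topspace X)"
    using a homeomorphic_imp_injective_map by blast
  have h': "homeomorphic_map X X h" "disjoint_family_on B P" "\<And>x. x \<in> topspace X - (\<Union>p\<in>P. B p) \<Longrightarrow> h x = x"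
    and hp: "\<And>p. p \<in> P \<Longrightarrow> closed_disk_in X (B p) \<and> C p \<subseteq> X interior_of B p \<and> h ` B p = B p \<and> h p = e p"
    using h by (auto simp: push_along_def)
  have bap: "b (a p) = p" if "p \<in> P" for p
    using ba P that by blast
  have BX: "B p \<subseteq> topspace X" if "p \<in> P" for p
    using hp[OF that] by (simp add: closed_disk_in_def)
  show ?thesis
    unfolding push_along_def
  proof (intro conjI ballI)
    show "homeomorphic_map Y Y (a \<circ> h \<circ> b)"
      using homeomorphic_map_compose[OF b homeomorphic_map_compose[OF h'(1) a]] by (simp add: comp_assoc)
    show "disjoint_family_on (\<lambda>q. a ` B (b q)) (a ` P)"
      unfolding disjoint_family_on_def
    proof (intro ballI impI)
      fix m n assume "m \<in> a ` P" "n \<in> a ` P" "m \<noteq> n"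
      then obtain p q where pq: "p \<in> P" "q \<in> P" "p \<noteq> q" "m = a p" "n = a q" by blast
      then have "a ` B p \<inter> a ` B q = a ` (B p \<inter> B q)"
        using inj_on_image_Int[OF inj BX BX] by simp
      then show "a ` B (b m) \<inter> a ` B (b n) = {}"
        using pq h'(2) bap by (simp add: disjoint_family_on_def)
    qed
    fix y assume y: "y \<in> topspace Y - (\<Union>q\<in>a ` P. a ` B (b q))"
    then have "b y \<notin> B p" if "p \<in> P" for p
      using that aby(1)[of y] bap[OF that] by (metis DiffD1 DiffD2 UN_I imageI)
    then have "h (b y) = b y"
      using h'(3)[of "b y"] aby(2) y by blast
    then show "(a \<circ> h \<circ> b) y = y"
      using aby(1) y by simp
  next
    fix q assume "q \<in> a ` P"
    then obtain p where p: "p \<in> P" "q = a p" by blast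
    have q: "b q = p"
      using p bap by simp
    have "homeomorphic_map (subtopology X (B p)) (subtopology Y (a ` B p)) a"
      using a BX[OF p(1)] homeomorphic_imp_surjective_map[OF a]
      by (intro homeomorphic_map_subtopologies) auto
    then have "subtopology Y (a ` B p) homeomorphic_space subtopology X (B p)"
      using homeomorphic_map_imp_homeomorphic_space homeomorphic_space_sym by blast
    moreover have "subtopology X (B p) homeomorphic_space top_of_set (cball (0::plane) 1)"
      using hp[OF p(1)] by (simp add: closed_disk_in_def)
    ultimately have "subtopology Y (a ` B p) homeomorphic_space top_of_set (cball (0::plane) 1)"
      by (rule homeomorphic_space_trans)
    moreover have "a ` B p \<subseteq> topspace Y"
      using BX[OF p(1)] homeomorphic_imp_surjective_map[OF a] by auto
    ultimately show "closed_disk_in Y (a ` B (b q))"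
      by (simp add: closed_disk_in_def q)
    have "openin Y (a ` (X interior_of B p))"
      using homeomorphic_imp_open_map[OF a] openin_interior_of[of X "B p"] by (auto simp: open_map_def)
    then have "a ` (X interior_of B p) \<subseteq> Y interior_of (a ` B p)"
      by (rule interior_of_maximal[OF image_mono[OF interior_of_subset]])
    then show "C' q \<subseteq> Y interior_of (a ` B (b q))"
      using hp[OF p(1)] C'[OF p(1)] p(2) q by auto
    have "(\<lambda>x. (a \<circ> h \<circ> b) (a x)) ` B p = (\<lambda>x. a (h x)) ` B p"
      using ba BX[OF p(1)] by (intro image_cong) auto
    then have "(a \<circ> h \<circ> b) ` (a ` B p) = a ` (h ` B p)"
      by (simp only: image_image)
    then show "(a \<circ> h \<circ> b) ` (a ` B (b q)) = a ` B (b q)"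
      using hp[OF p(1)] q by simp
    show "(a \<circ> h \<circ> b) q = e' q"
      using hp[OF p(1)] C'[OF p(1)] p q by simp
  qed
qed

section \<open>The maps determined by presentation data\<close>

lemma presentation_data_lattice:
  assumes "presentation_data D"
  shows "integral_lattice (lattice1 D)" "lattice1 D \<subseteq> int_lattice"
  using assms integral_lattice_lattice1[of D] by (auto simp: presentation_data_def)

lemma presentation_data_arc:
  assumes "presentation_data D" "p \<in> P1 D"
  shows "arc_from D p 0 = p" "arc_from D p 1 \<in> proj1 D ` int_lattice" "\<exists>s e. segment_lift D (arc_from D p) s e"
  using assms unfolding presentation_data_def by blast+

lemma id_bar_proj:
  assumes "integral_lattice (lattice1 D)" "lattice1 D \<subseteq> int_lattice"
  shows "id_bar D (proj1 D x) = proj int_lattice x"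
proof -
  interpret L: integral_lattice "lattice1 D" by fact
  interpret Z: integral_lattice int_lattice
    by (rule integral_lattice_int_lattice)
  have "induced (lattice1 D) int_lattice id (proj1 D x) = proj int_lattice (id x)"
  proof (rule induced_proj[OF L.zero_mem])
    fix y assume "y \<in> proj1 D x"
    then have "y \<in> proj int_lattice x"
      using assms(2) unfolding mem_proj by (meson subsetD)
    then show "proj int_lattice (id y) = proj int_lattice (id x)"
      using Z.proj_eq_iff[of x y] by simp
  qed
  then show ?thesis
    by (simp add: id_bar_def)
qed

lemma mark_mem:
  assumes "presentation_data D"
  shows "mark D \<in> lattice1 D"
proof -
  interpret L: integral_lattice "lattice1 D"
    using assms by (rule presentation_data_lattice)
  have "lam1 D = of_int 1 *\<^sub>R lam1 D + of_int 0 *\<^sub>R lam2 D" "lam2 D = of_int 0 *\<^sub>R lam1 D + of_int 1 *\<^sub>R lam2 D"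
    by auto
  then have "lam1 D \<in> lattice1 D" "lam2 D \<in> lattice1 D"
    unfolding lattice1_def by blast+
  then show ?thesis
    using assms L.zero_mem L.add_mem by (auto simp: presentation_data_def)
qed

lemma homeomorphic_maps_phi:
  assumes D: "presentation_data D"
  obtains g where "homeomorphic_maps sphere2 (sphere1 D) (phi D) g"
    and "\<And>x. phi D (proj int_lattice x) = proj1 D (Phi D x)"
    and "phi D ` P2 = P1 D"
proof -
  have "det (basis_matrix D) \<noteq> 0"
    using D by (auto simp: presentation_data_def)
  then show thesis
    using homeomorphic_maps_affine[OF integral_lattice_int_lattice presentation_data_lattice(1)[OF D] _
        lattice1_eq_image[symmetric] mark_mem[OF D], of "Phi D"] that
    by (auto simp: Phi_def phi_def)
qed

definition arc_image :: "net_data \<Rightarrow> plane set \<Rightarrow> plane set set" where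
  "arc_image D p = arc_from D p ` {0..1}"

lemma push_homeomorphism_imp_push_along:
  assumes "push_homeomorphism D h"
  obtains B where "push_along (sphere1 D) (P1 D) (arc_image D) (\<lambda>p. arc_from D p 1) B h"
proof -
  obtain B where "disjoint_family_on B (P1 D)"
    and "\<forall>x \<in> topspace (sphere1 D) - (\<Union>p\<in>P1 D. B p). h x = x"
    and "\<forall>p\<in>P1 D. closed_disk_in (sphere1 D) (B p) \<and>
           arc_from D p ` {0..1} \<subseteq> sphere1 D interior_of B p \<and>
           h ` B p = B p \<and> h p = arc_from D p 1 \<and>
           (degenerate_arc (arc_from D p) \<longrightarrow> (\<forall>x\<in>B p. h x = x))"
    using assms unfolding push_homeomorphism_def by (elim conjE exE) (rule that)
  then have "push_along (sphere1 D) (P1 D) (arc_image D) (\<lambda>p. arc_from D p 1) B h"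
    using assms by (simp add: push_along_def arc_image_def push_homeomorphism_def)
  then show thesis
    by (rule that)
qed

text \<open>Connectedness is inherited from a lifted segment through the continuous quotient
  map.\<close>

lemma arc_image:
  assumes D: "presentation_data D" and p: "p \<in> P1 D"
  shows "connectedin (sphere1 D) (arc_image D p)" "p \<in> arc_image D p" "arc_from D p 1 \<in> arc_image D p"
proof -
  obtain s e where "segment_lift D (arc_from D p) s e"
    using presentation_data_arc(3)[OF D p] by blast
  then have "arc_image D p = proj1 D ` closed_segment s e"
    unfolding segment_lift_def arc_image_def linepath_image_01[symmetric] image_image by (auto intro: image_cong)
  moreover have "connectedin euclidean (closed_segment s e)"
    by (simp add: connectedin_iff_connected)
  ultimately show "connectedin (sphere1 D) (arc_image D p)"
    using connectedin_continuous_map_image[OF quotient_imp_continuous_map[OF quotient_map_proj]] by metis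
  show "p \<in> arc_image D p"
    unfolding arc_image_def using presentation_data_arc(1)[OF D p] by (intro image_eqI[of _ _ 0]) auto
  show "arc_from D p 1 \<in> arc_image D p"
    unfolding arc_image_def by simp
qed

text \<open>\<open>h \<circ> phi D\<close> is a homeomorphism, so the branching is that of
  \<open>id_bar D\<close>. Marked points go to arc endpoints, which project to
  \<open>P2\<close>.\<close>

lemma branched_covering_corresponding_map:
  assumes D: "presentation_data D" and F: "corresponding_map D F"
  shows "branched_covering sphere2 sphere2 F" "F ` P2 \<subseteq> P2"
proof -
  obtain h where h: "push_homeomorphism D h" and F: "F = id_bar D \<circ> h \<circ> phi D"
    using F by (auto simp: corresponding_map_def)
  obtain g where g: "homeomorphic_maps sphere2 (sphere1 D) (phi D) g" "phi D ` P2 = P1 D"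
    using homeomorphic_maps_phi[OF D] by metis
  note L = presentation_data_lattice[OF D]
  have "homeomorphic_map (sphere1 D) (sphere1 D) h"
    using h by (simp add: push_homeomorphism_def)
  then have "homeomorphic_map sphere2 (sphere1 D) (h \<circ> phi D)"
    using homeomorphic_maps_imp_map[OF g(1)] homeomorphic_map_compose by blast
  moreover have "branched_covering (sphere1 D) sphere2 (id_bar D)"
    unfolding id_bar_def using L integral_lattice_int_lattice by (intro branched_covering_induced_id)
  ultimately show "branched_covering sphere2 sphere2 F"
    by (intro branched_covering_compose_homeomorphism[of "sphere1 D" sphere2 "id_bar D" sphere2 "h \<circ> phi D"]) (auto simp: F)
  show "F ` P2 \<subseteq> P2"
  proof (rule image_subsetI)
    fix p assume "p \<in> P2"
    then have "phi D p \<in> P1 D"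
      using g(2) by blast
    then have "h (phi D p) \<in> proj1 D ` int_lattice"
      using h presentation_data_arc(2)[OF D] unfolding push_homeomorphism_def by metis
    then show "F p \<in> P2"
      using id_bar_proj[OF L] by (auto simp: F cone_points_def)
  qed
qed

section \<open>Integer matrices acting on diagrams and on the sphere\<close>

lemma lin_uminus: "lin (- A) x = - lin A x"
  by (simp add: lin_def vec_eq_iff matrix_vector_mult_def map_matrix_def sum_negf)

lemma lin_minus: "lin A (- x) = - lin A x"
  by (simp add: lin_def vec_eq_iff matrix_vector_mult_def sum_negf)

lemma lin_mat_1: "lin (mat 1) x = x"
  by (simp add: lin_def vec_eq_iff matrix_vector_mult_def map_matrix_def mat_def if_distrib[of real_of_int] if_distrib[of "\<lambda>y. y * _"] cong: if_cong)

lemma act_act_minus: "act A (act (- mat 1) E) = act (- A) E"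
  by (simp add: act_def lin_uminus lin_minus lin_mat_1 image_image case_prod_unfold)

lemma act_1: "act (mat 1) E = E"
  by (simp add: act_def lin_mat_1 case_prod_unfold)

lemma act_minus_act_minus: "act (- mat 1) (act (- mat 1) E) = E"
  using act_act_minus[of "- mat 1" E] by (simp add: act_1)

lemma det_map_matrix: "det (map_matrix real_of_int A) = real_of_int (det A)" for A :: "int^2^2"
  by (simp add: det_2 map_matrix_def)

lemma det_uminus_2: "det (- A) = det A" for A :: "int^2^2"
  by (simp add: det_2)

lemma lin_int_lattice: "x \<in> int_lattice \<Longrightarrow> lin A x \<in> int_lattice"
  by (auto simp: int_lattice_def lin_def matrix_vector_mult_def map_matrix_def sum_2)

lemma A2_map_proj: "A2_map A (proj int_lattice x) = proj int_lattice (lin A x)"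
proof -
  interpret Z: integral_lattice int_lattice
    by (rule integral_lattice_int_lattice)
  have "linear (lin A)"
    unfolding lin_def[abs_def] by (rule matrix_vector_mul_linear)
  note lin = linear_add[OF this] linear_scale[OF this]
  show ?thesis
    unfolding A2_map_def
  proof (rule induced_proj[OF Z.zero_mem])
    fix y assume "y \<in> proj int_lattice x"
    then obtain l s where l: "l \<in> int_lattice" and s: "s \<in> {1, -1::real}" and y: "y = 2 *\<^sub>R l + s *\<^sub>R x"
      unfolding mem_proj by blast
    have "lin A y = 2 *\<^sub>R lin A l + s *\<^sub>R lin A x"
      by (simp add: y lin)
    then show "proj int_lattice (lin A y) = proj int_lattice (lin A x)"
      using Z.proj_affine[OF lin_int_lattice[OF l] s] by simp
  qed
qed

text \<open>Opposite points of the plane lie in the same orbit. This removes the sign ambiguity of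
  projective classes.\<close>

lemma A2_map_uminus:
  assumes "c \<in> topspace sphere2"
  shows "A2_map (- A) c = A2_map A c"
proof -
  interpret Z: integral_lattice int_lattice
    by (rule integral_lattice_int_lattice)
  obtain x where "c = proj int_lattice x"
    using assms by (auto simp: topspace_qsphere)
  then show ?thesis
    using Z.proj_affine[OF Z.zero_mem, of "-1" "lin A x"] by (simp add: A2_map_proj lin_uminus)
qed

lemma lin_linepath: "lin A (linepath s e t) = linepath (lin A s) (lin A e) t"
  by (simp add: lin_def linepath_def matrix_vector_right_distrib matrix_vector_mult_scaleR)

text \<open>With \<open>?b\<close> induced by \<open>A\<close>, the push
  \<open>?b \<circ> h \<circ> bi\<close> equals \<open>h' \<circ> \<psi>\<close>; conjugating
  \<open>\<psi>\<close> by \<open>phi D'\<close> produces \<open>\<theta>\<close> on the common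
  sphere.\<close>

lemma isotopy_class_of_act:
  assumes A: "det A > 0" and D: "presentation_data D" and D': "presentation_data D'"
    and act: "diagram_of D' = act A (diagram_of D)"
    and F: "corresponding_map D F" and F': "corresponding_map D' F'"
  obtains \<theta> where "isotopic_to_id_rel sphere2 P2 \<theta>" "\<And>x. x \<in> topspace sphere2 \<Longrightarrow> A2_map A (F x) = F' (\<theta> x)"
proof -
  obtain h where h: "push_homeomorphism D h" and F: "F = id_bar D \<circ> h \<circ> phi D"
    using F by (auto simp: corresponding_map_def)
  obtain h' where h': "push_homeomorphism D' h'" and F': "F' = id_bar D' \<circ> h' \<circ> phi D'"
    using F' by (auto simp: corresponding_map_def)
  note L = presentation_data_lattice[OF D] and L' = presentation_data_lattice[OF D']
  let ?T = "lin A" and ?N = "map_matrix real_of_int A"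
  have lam: "lam1 D' = ?T (lam1 D)" "lam2 D' = ?T (lam2 D)" "mark D' = ?T (mark D)"
    and lifts: "{(s, e). \<exists>p\<in>P1 D'. segment_lift D' (arc_from D' p) s e} =
      (\<lambda>(s, e). (?T s, ?T e)) ` {(s, e). \<exists>p\<in>P1 D. segment_lift D (arc_from D p) s e}"
    using act by (auto simp: diagram_of_def act_def)
  have "det ?N \<noteq> 0"
    using A by (simp add: det_map_matrix)
  have basis: "basis_matrix D' *v x = ?T (basis_matrix D *v x)" for x
    by (simp add: basis_matrix_mult lam lin_def matrix_vector_right_distrib matrix_vector_mult_scaleR)
  then have lattice: "(*v) ?N ` lattice1 D = lattice1 D'"
    unfolding lattice1_eq_image image_image by (simp add: lin_def)
  have Phi: "Phi D' x = ?T (Phi D x)" for x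
    using basis by (simp add: Phi_def lam(3) lin_def matrix_vector_right_distrib)
  interpret L': integral_lattice "lattice1 D'" by (rule L'(1))
  let ?b = "induced (lattice1 D) (lattice1 D') ?T"
  obtain bi where b: "homeomorphic_maps (sphere1 D) (sphere1 D') ?b bi"
    and b_proj: "\<And>x. ?b (proj1 D x) = proj1 D' (?T x)" and bP: "?b ` P1 D = P1 D'"
    using homeomorphic_maps_affine[OF L(1) L'(1) \<open>det ?N \<noteq> 0\<close> lattice L'.zero_mem, of ?T]
    by (auto simp: lin_def)
  have arcs: "arc_from D' (?b p) t = ?b (arc_from D p t)" if p: "p \<in> P1 D" and t: "t \<in> {0..1}" for p t
  proof -
    obtain s e where se: "segment_lift D (arc_from D p) s e"
      using presentation_data_arc(3)[OF D p] by blast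
    then have "(?T s, ?T e) \<in> {(s, e). \<exists>p\<in>P1 D'. segment_lift D' (arc_from D' p) s e}"
      unfolding lifts using p by (intro image_eqI[of _ _ "(s, e)"]) auto
    then obtain p' where p': "p' \<in> P1 D'" "segment_lift D' (arc_from D' p') (?T s) (?T e)"
      by blast
    have eq: "arc_from D' p' t = ?b (arc_from D p t)" if "t \<in> {0..1}" for t
      using se p'(2) that b_proj by (simp add: segment_lift_def lin_linepath)
    note presentation_data_arc(1)[OF D p] presentation_data_arc(1)[OF D' p'(1)]
    \<comment> \<open>The set of drawn lifts does not record which arc a segment belongs to. As
      segments are directed, the value at parameter 0 identifies the initial point and hence the
      arc.\<close>
    then have "p' = ?b p"
      using eq[of 0] by simp
    then show ?thesis
      using eq t by simp
  qed
  have P1_top: "P1 D \<subseteq> topspace (sphere1 D)" "P1 D' \<subseteq> topspace (sphere1 D')" "P2 \<subseteq> topspace sphere2"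
    by (auto simp: cone_points_def topspace_qsphere)
  obtain B where B: "push_along (sphere1 D) (P1 D) (arc_image D) (\<lambda>p. arc_from D p 1) B h"
    using push_homeomorphism_imp_push_along[OF h] .
  obtain B' where B': "push_along (sphere1 D') (P1 D') (arc_image D') (\<lambda>p. arc_from D' p 1) B' h'"
    using push_homeomorphism_imp_push_along[OF h'] .
  have "push_along (sphere1 D') (?b ` P1 D) (arc_image D') (\<lambda>p. arc_from D' p 1) (\<lambda>q. ?b ` B (bi q)) (?b \<circ> h \<circ> bi)"
  proof (rule push_along_conjugate[OF B b P1_top(1)])
    fix p assume p: "p \<in> P1 D"
    show "arc_image D' (?b p) = ?b ` arc_image D p \<and> arc_from D' (?b p) 1 = ?b (arc_from D p 1)"
      using arcs[OF p] by (simp add: arc_image_def image_image)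
    show "arc_image D p \<subseteq> topspace (sphere1 D)"
      using arc_image(1)[OF D p] by (rule connectedin_subset_topspace)
  qed
  then have Bg: "push_along (sphere1 D') (P1 D') (arc_image D') (\<lambda>p. arc_from D' p 1) (\<lambda>q. ?b ` B (bi q)) (?b \<circ> h \<circ> bi)"
    unfolding bP .
  have "connectedin (sphere1 D') (arc_image D' p) \<and> p \<in> arc_image D' p \<and> arc_from D' p 1 \<in> arc_image D' p"
    if "p \<in> P1 D'" for p
    using arc_image[OF D' that] by blast
  note push_unique = surface.push_along_unique[OF surface_qsphere[OF L'(1)] finite_P1[OF L'(2)] P1_top(2) this B' Bg]
  obtain \<psi> where \<psi>: "isotopic_to_id_rel (sphere1 D') (P1 D') \<psi>"
    "\<And>x. x \<in> topspace (sphere1 D') \<Longrightarrow> (?b \<circ> h \<circ> bi) x = h' (\<psi> x)"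
    using push_unique by metis
  obtain g where g: "homeomorphic_maps sphere2 (sphere1 D) (phi D) g"
    and phi: "\<And>x. phi D (proj int_lattice x) = proj1 D (Phi D x)"
    using homeomorphic_maps_phi[OF D] by metis
  obtain g' where g': "homeomorphic_maps sphere2 (sphere1 D') (phi D') g'"
    and phi': "\<And>x. phi D' (proj int_lattice x) = proj1 D' (Phi D' x)" and phiP: "phi D' ` P2 = P1 D'"
    using homeomorphic_maps_phi[OF D'] by metis
  show thesis
  proof (rule that)
    show "isotopic_to_id_rel sphere2 P2 (g' \<circ> \<psi> \<circ> phi D')"
      using phiP P1_top by (intro isotopic_to_id_rel_conjugate[OF \<psi>(1) g']) auto
    fix x assume x: "x \<in> topspace sphere2"
    then obtain z where z: "x = proj int_lattice z"
      by (auto simp: topspace_qsphere)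
    have into: "phi D x \<in> topspace (sphere1 D)" "phi D' x \<in> topspace (sphere1 D')"
      using phi phi' z by (auto simp: topspace_qsphere)
    have phi_b: "phi D' x = ?b (phi D x)"
      by (simp add: z phi phi' b_proj Phi)
    have "bi (phi D' x) = phi D x"
      using b into(1) by (simp add: phi_b homeomorphic_maps_def)
    then have h\<psi>: "h' (\<psi> (phi D' x)) = ?b (h (phi D x))"
      using \<psi>(2)[OF into(2)] by simp
    have "\<psi> (phi D' x) \<in> topspace (sphere1 D')"
      using homeomorphic_imp_surjective_map[OF isotopic_to_id_rel_imp(1)[OF \<psi>(1)]] into(2) by blast
    then have "phi D' (g' (\<psi> (phi D' x))) = \<psi> (phi D' x)"
      using g' by (simp add: homeomorphic_maps_def)
    then have F'\<theta>: "F' ((g' \<circ> \<psi> \<circ> phi D') x) = id_bar D' (?b (h (phi D x)))"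
      using h\<psi> by (simp add: F')
    have "homeomorphic_map (sphere1 D) (sphere1 D) h"
      using h by (simp add: push_homeomorphism_def)
    then have "h (phi D x) \<in> topspace (sphere1 D)"
      using homeomorphic_imp_surjective_map into(1) by blast
    then obtain w where "h (phi D x) = proj1 D w"
      by (auto simp: topspace_qsphere)
    then show "A2_map A (F x) = F' ((g' \<circ> \<psi> \<circ> phi D') x)"
      unfolding F'\<theta> by (simp add: F b_proj id_bar_proj[OF L] id_bar_proj[OF L'] A2_map_proj)
  qed
qed

theorem theorem1p2:
  fixes A :: "int^2^2" and \<D> \<D>' :: net_diagram and F F' :: "plane set \<Rightarrow> plane set"
  assumes "det A > 0"
    and "net_map_diagram \<D>" and "net_map_diagram \<D>'"
    and "act A ` proj_class \<D> = proj_class \<D>'"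
    and "class_map (proj_class \<D>) F" and "class_map (proj_class \<D>') F'"
  shows "same_isotopy_class_rel sphere2 P2 F' (A2_map A \<circ> F)"
proof -
  obtain D where D: "presentation_data D" "diagram_of D \<in> proj_class \<D>" "corresponding_map D F"
    using assms(5) by (auto simp: class_map_def net_presentation_def)
  obtain D' where D': "presentation_data D'" "diagram_of D' \<in> proj_class \<D>'" "corresponding_map D' F'"
    using assms(6) by (auto simp: class_map_def net_presentation_def)
  \<comment> \<open>The equality of classes only gives some representative \<open>E\<close> that
    \<open>A\<close> sends to the diagram of \<open>D'\<close>; it is the diagram of
    \<open>D\<close> or its negative, and the sign is absorbed into \<open>A'\<close>.\<close>
  obtain E where E: "E \<in> proj_class \<D>" "diagram_of D' = act A E"
    using D'(2) assms(4) by blast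
  have "E = diagram_of D \<or> E = act (- mat 1) (diagram_of D)"
    using E(1) D(2) by (auto simp: proj_class_def act_minus_act_minus)
  then have "diagram_of D' = act A (diagram_of D) \<or> diagram_of D' = act (- A) (diagram_of D)"
    using E(2) act_act_minus by auto
  then obtain A' where A': "A' = A \<or> A' = - A" "diagram_of D' = act A' (diagram_of D)"
    by blast
  \<comment> \<open>In even dimension a change of sign preserves the determinant.\<close>
  then have "det A' > 0"
    using assms(1) det_uminus_2 by auto
  then obtain \<theta> where \<theta>: "isotopic_to_id_rel sphere2 P2 \<theta>"
    "\<And>x. x \<in> topspace sphere2 \<Longrightarrow> A2_map A' (F x) = F' (\<theta> x)"
    using isotopy_class_of_act[OF _ D(1) D'(1) A'(2) D(3) D'(3)] by blast
  note FP = branched_covering_corresponding_map[OF D(1,3)]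
    and F'P = branched_covering_corresponding_map[OF D'(1,3)]
  have F_top: "F x \<in> topspace sphere2" if "x \<in> topspace sphere2" for x
    using FP(1) that unfolding branched_covering_def by blast
  have eq: "(A2_map A \<circ> F) x = F' (\<theta> x)" if "x \<in> topspace sphere2" for x
    using \<theta>(2)[OF that] A'(1) A2_map_uminus[OF F_top[OF that]] by auto
  \<comment> \<open>The branching of the composite is read off from \<open>F'\<close>, of which it
    is a reparametrization by the homeomorphism \<open>\<theta>\<close>.\<close>
  have "branched_covering sphere2 sphere2 (A2_map A \<circ> F)"
    using F'P(1) isotopic_to_id_rel_imp(1)[OF \<theta>(1)] eq by (rule branched_covering_compose_homeomorphism)
  moreover have "(A2_map A \<circ> F) ` P2 \<subseteq> P2"
  proof (rule image_subsetI)
    fix p assume p: "p \<in> P2"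
    then have "p \<in> topspace sphere2"
      by (auto simp: cone_points_def topspace_qsphere)
    then have "(A2_map A \<circ> F) p = F' p"
      using eq isotopic_to_id_rel_imp(2)[OF \<theta>(1) p] by simp
    then show "(A2_map A \<circ> F) p \<in> P2"
      using F'P(2) p by auto
  qed
  ultimately show ?thesis
    unfolding same_isotopy_class_rel_def using F'P \<theta>(1) eq by blast
qed

end
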